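(* Let $p>6$ and assume that $h$ satisfies $(h_1)$ and $(h_2)$. Then equation (E) has a ground state sign-changing solution $v\in H^{s,2}$, i.e. $v\in\mathcal{M}_{s,2}$, $J_{s,2}'(v)=0$ and $J_{s,2}(v)=\inf_{w\in\mathcal{M}_{s,2}}J_{s,2}(w)$.
   Context: Let $d\ge 1$ and $s\in(0,1)$. $\mathbb{Z}^d$ is the integer lattice graph (vertices $\mathbb{Z}^d$, edges between $x,y$ with $\sum_i|x_i-y_i|=1$), with graph distance $|x-y|=\sum_{i=1}^d|x_i-y_i|$ and counting measure $\mu$; $\int_{\mathbb{Z}^d}f\,d\mu:=\sum_{x\in\mathbb{Z}^d}f(x)$. The weight $w_s(x,y)$, defined for $x\neq y$, is symmetric, positive, and satisfies $c_{s,d}|x-y|^{-d-2s}\le w_s(x,y)\le C_{s,d}|x-y|^{-d-2s}$ for some constants $0<c_{s,d}\le C_{s,d}$. For $u,v:\mathbb{Z}^d\to\mathbb{R}$ set $\nabla^s u\nabla^s v(x)=\frac12\sum_{y\neq x}w_s(x,y)(u(x)-u(y))(v(x)-v(y))$, $|\nabla^s u|^2(x)=\nabla^s u\nabla^s u(x)$, $\|\nabla^s u\|_2^2:=\int_{\mathbb{Z}^d}|\nabla^s u|^2d\mu$, and $(-\Delta)^s u(x)=\sum_{y\neq x}w_s(x,y)(u(x)-u(y))$; $\|u\|_q$ denotes the $\ell^q(\mathbb{Z}^d)$ norm. Fix constants $a,b>0$ and $p>2$. The potential $h:\mathbb{Z}^d\to\mathbb{R}$ may satisfy: $(h_1)$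 there is $h_0>0$ with $h(x)\ge h_0$ for all $x$; $(h_2)$ there is $x_0\in\mathbb{Z}^d$ with $h(x)\to\infty$ as $|x-x_0|\to\infty$. $W^{s,2}(\mathbb{Z}^d)$ is the completion of finitely supported functions under $\|u\|_{W^{s,2}}^2=\int(|\nabla^s u|^2+u^2)d\mu$, and $H^{s,2}=\{u\in W^{s,2}:\int h u^2d\mu<\infty\}$ is the Hilbert space with inner product $\langle u,v\rangle_{H^{s,2}}=\int(a\nabla^s u\nabla^s v+huv)d\mu$ and norm $\|u\|_{H^{s,2}}$. Equation (E) is $\left(a+b\int_{\mathbb{Z}^d}|\nabla^s u|^2d\mu\right)(-\Delta)^s u+h(x)u=|u|^{p-2}u\log u^2$ on $\mathbb{Z}^d$ (with $|t|^{p-2}t\log t^2:=0$ at $t=0$). The energy is $J_{s,2}(u)=\frac12\|u\|_{H^{s,2}}^2+\frac b4\|\nabla^s u\|_2^4+\frac{2}{p^2}\int|u|^pd\mu-\frac1p\int|u|^p\log u^2d\mu$, a $C^1$ functional on $H^{s,2}$ with $\langle J_{s,2}'(u),\phi\rangle=\int(a\nabla^s u\nabla^s\phi+hu\phi)d\mu+b\|\nabla^s u\|_2^2\int\nabla^s u\nabla^s\phi\,d\mu-\int|u|^{p-2}u\phi\log u^2d\mu$. A weak solution is a critical point of $J_{s,2}$; nontrivial means $\neq0$. $u^+=\max\{u,0\}$, $u^-=\min\{u,0\}$. Nehari manifold: $\mathcal{N}_{s,2}=\{v\in H^{s,2}\setminus\{0\}:\langle J_{s,2}'(v),v\rangle=0\}$.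 Sign-changing Nehari set: $\mathcal{M}_{s,2}=\{v\in H^{s,2}: v^\pm\neq0,\ \langle J_{s,2}'(v),v^+\rangle=\langle J_{s,2}'(v),v^-\rangle=0\}$. A ground state solution is a nontrivial weak solution $u$ with $J_{s,2}(u)=\inf_{\mathcal{N}_{s,2}}J_{s,2}$; a sign-changing solution is a weak solution $u$ with $u^\pm\not\equiv0$; a ground state sign-changing solution is a sign-changing solution $u$ with $J_{s,2}(u)=\inf_{\mathcal{M}_{s,2}}J_{s,2}$. For $u\in H^{s,2}$, $K(u)=\sum_{x}\sum_{y\neq x}w_s(x,y)[u^+(y)u^-(x)+u^-(y)u^+(x)]$. *)

theory Defs
  imports "HOL-Analysis.Analysis"
begin

(* The lattice Z^d is modelled as int^'n, d = CARD('n) (>= 1 automatically). *)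

definition ldist :: "int^'n \<Rightarrow> int^'n \<Rightarrow> int" where
  "ldist x y = (\<Sum>i\<in>UNIV. \<bar>x$i - y$i\<bar>)"

definition gradprod :: "(int^'n \<Rightarrow> int^'n \<Rightarrow> real) \<Rightarrow> (int^'n \<Rightarrow> real) \<Rightarrow> (int^'n \<Rightarrow> real) \<Rightarrow> int^'n \<Rightarrow> real" where
  "gradprod w u v x = (1/2) * (\<Sum>\<^sub>\<infinity>y\<in>UNIV - {x}. w x y * (u x - u y) * (v x - v y))"

definition gradsq :: "(int^'n \<Rightarrow> int^'n \<Rightarrow> real) \<Rightarrow> (int^'n \<Rightarrow> real) \<Rightarrow> int^'n \<Rightarrow> real" where
  "gradsq w u x = gradprod w u u x"

definition gradnorm2 :: "(int^'n \<Rightarrow> int^'n \<Rightarrow> real) \<Rightarrow> (int^'n \<Rightarrow> real) \<Rightarrow> real" where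
  "gradnorm2 w u = (\<Sum>\<^sub>\<infinity>x. gradsq w u x)"

definition Wnorm2 :: "(int^'n \<Rightarrow> int^'n \<Rightarrow> real) \<Rightarrow> (int^'n \<Rightarrow> real) \<Rightarrow> real" where
  "Wnorm2 w u = (\<Sum>\<^sub>\<infinity>x. gradsq w u x + (u x)^2)"

(* W^{s,2}: functions of finite W-norm that are W-limits of finitely supported functions
   (the completion, realised inside the function space) *)
definition W_space :: "(int^'n \<Rightarrow> int^'n \<Rightarrow> real) \<Rightarrow> (int^'n \<Rightarrow> real) set" where
  "W_space w = {u. (\<forall>x. (\<lambda>y. w x y * (u x - u y)^2) summable_on (UNIV - {x}))
      \<and> (\<lambda>x. gradsq w u x + (u x)^2) summable_on UNIV
      \<and> (\<exists>\<phi> :: nat \<Rightarrow> int^'n \<Rightarrow> real. (\<forall>k. finite {x. \<phi> k x \<noteq> 0})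
            \<and> (\<lambda>k. Wnorm2 w (\<lambda>x. \<phi> k x - u x)) \<longlonglongrightarrow> 0)}"

definition H_space :: "(int^'n \<Rightarrow> int^'n \<Rightarrow> real) \<Rightarrow> (int^'n \<Rightarrow> real) \<Rightarrow> (int^'n \<Rightarrow> real) set" where
  "H_space w h = {u \<in> W_space w. (\<lambda>x. h x * (u x)^2) summable_on UNIV}"

definition Hnorm2 :: "(int^'n \<Rightarrow> int^'n \<Rightarrow> real) \<Rightarrow> real \<Rightarrow> (int^'n \<Rightarrow> real) \<Rightarrow> (int^'n \<Rightarrow> real) \<Rightarrow> real" where
  "Hnorm2 w a h u = (\<Sum>\<^sub>\<infinity>x. a * gradsq w u x + h x * (u x)^2)"

definition logterm :: "real \<Rightarrow> real \<Rightarrow> real" where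
  "logterm p t = (if t = 0 then 0 else \<bar>t\<bar> powr p * ln (t^2))"

definition fnl :: "real \<Rightarrow> real \<Rightarrow> real" where
  "fnl p t = (if t = 0 then 0 else \<bar>t\<bar> powr (p - 2) * t * ln (t^2))"

definition Jfun :: "(int^'n \<Rightarrow> int^'n \<Rightarrow> real) \<Rightarrow> real \<Rightarrow> real \<Rightarrow> real \<Rightarrow> (int^'n \<Rightarrow> real) \<Rightarrow> (int^'n \<Rightarrow> real) \<Rightarrow> real" where
  "Jfun w a b p h u = (1/2) * Hnorm2 w a h u + (b/4) * (gradnorm2 w u)^2
     + (2 / p^2) * (\<Sum>\<^sub>\<infinity>x. \<bar>u x\<bar> powr p) - (1/p) * (\<Sum>\<^sub>\<infinity>x. logterm p (u x))"

definition dJ :: "(int^'n \<Rightarrow> int^'n \<Rightarrow> real) \<Rightarrow> real \<Rightarrow> real \<Rightarrow> real \<Rightarrow> (int^'n \<Rightarrow> real) \<Rightarrow> (int^'n \<Rightarrow> real) \<Rightarrow> (int^'n \<Rightarrow> real) \<Rightarrow> real" where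
  "dJ w a b p h u \<phi> = (\<Sum>\<^sub>\<infinity>x. a * gradprod w u \<phi> x + h x * u x * \<phi> x)
     + b * gradnorm2 w u * (\<Sum>\<^sub>\<infinity>x. gradprod w u \<phi> x)
     - (\<Sum>\<^sub>\<infinity>x. fnl p (u x) * \<phi> x)"

definition pos_part :: "(int^'n \<Rightarrow> real) \<Rightarrow> int^'n \<Rightarrow> real" where
  "pos_part u = (\<lambda>x. max (u x) 0)"

definition neg_part :: "(int^'n \<Rightarrow> real) \<Rightarrow> int^'n \<Rightarrow> real" where
  "neg_part u = (\<lambda>x. min (u x) 0)"

definition M_set :: "(int^'n \<Rightarrow> int^'n \<Rightarrow> real) \<Rightarrow> real \<Rightarrow> real \<Rightarrow> real \<Rightarrow> (int^'n \<Rightarrow> real) \<Rightarrow> (int^'n \<Rightarrow> real) set" where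
  "M_set w a b p h = {v \<in> H_space w h. pos_part v \<noteq> (\<lambda>_. 0) \<and> neg_part v \<noteq> (\<lambda>_. 0)
      \<and> dJ w a b p h v (pos_part v) = 0 \<and> dJ w a b p h v (neg_part v) = 0}"

end

(* Put J(s,t) = J(s v^+ + t v^-). In the variables s^p, t^p this map is strictly concave, because its
   polynomial part has degree at most 4 < p and because -x ln x is strictly concave. Hence (1,1) is the
   unique maximum point of J(s,t) if v lies on M, and every fibre meets M.
   A minimising sequence on M has bounded norm and converges pointwise along a subsequence. On M both
   v^+ and -v^- exceed 1 somewhere, necessarily in a fixed finite set where h is not large, so the limit is
   sign-changing. The logarithmic term is positive only where |v| > 1, again in a fixed finite set, so J is
   lower semicontinuous by Fatou's lemma, and the projection of the limit to M is a minimiser.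
   If the derivative of J at the minimiser in the direction of a point mass did not vanish, a small shift at
   that point would lower J(s,t) uniformly for (s,t) near (1,1); the maximum over a small square would stay
   in the interior and give a point of M with smaller energy. *)

theory Submission
  imports Defs "HOL-Complex_Analysis.Great_Picard" "HOL-Real_Asymp.Real_Asymp"
begin

section \<open>Scalar nonlinearity\<close>

text \<open>The two parts of v do not decouple: the nonlocal form and the Kirchhoff square both mix
  v^+ with v^-, so J(s,t) is not a sum of one-variable functions. A sign saves the argument: the
  form of v^+ against v^- is nonnegative, so the mixed monomials have nonnegative coefficients, and
  weighted AM-GM replaces each monomial by its tangent in s^p, t^p. Two facts on the lattice replace
  the analysis in H^{s,2}. The row sums of w are bounded, so the gradient energy is controlled by
  the l^2 norm, and membership in H^{s,2} only means that the sum of h u^2 is finite. A bound on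
  that sum confines the values of modulus at least 1 to a finite set, so pointwise limits suffice
  and no compact embedding enters. A shift at one point x is compatible with the fibres: as long as
  it does not push the value at x across 0, it commutes with (s,t)-scaling up to a factor, and J
  along it is an explicit function of one real variable. Discrete integration by parts then passes
  from point masses to all test functions.\<close>

lemma logterm_mult: "logterm p (s * t) = \<bar>s\<bar> powr p * logterm p t + \<bar>t\<bar> powr p * logterm p s"
  by (auto simp: logterm_def abs_mult powr_mult power_mult_distrib ln_mult algebra_simps)

lemma logterm_minus: "logterm p (- t) = logterm p t"
  by (simp add: logterm_def)

lemma abs_powr_ln_tendsto_0:
  fixes q :: real
  assumes "q > 0"
  shows "((\<lambda>t. \<bar>t\<bar> powr q * ln (t\<^sup>2)) \<longlongrightarrow> 0) (at 0)"
proof -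
  have r: "((\<lambda>t::real. t powr q * (2 * ln t)) \<longlongrightarrow> 0) (at_right 0)"
    using assms by real_asymp
  have 1: "((\<lambda>t. \<bar>t\<bar> powr q * ln (t\<^sup>2)) \<longlongrightarrow> 0) (at_right 0)"
    by (rule Lim_transform_eventually[OF r])
      (auto simp: eventually_at_filter ln_realpow)
  have 2: "((\<lambda>t. \<bar>t\<bar> powr q * ln (t\<^sup>2)) \<longlongrightarrow> 0) (at_left 0)"
    using 1 by (simp add: filterlim_at_left_to_right[where a = 0])
  show ?thesis
    using 1 2 by (simp add: filterlim_split_at)
qed

lemma isCont_abs_powr_ln:
  fixes q :: real
  assumes "q > 0"
  shows "isCont (\<lambda>t. \<bar>t\<bar> powr q * ln (t\<^sup>2)) t"
proof (cases "t = 0")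
  case True
  then show ?thesis
    using abs_powr_ln_tendsto_0[OF assms] by (simp add: isCont_def)
next
  case False
  then show ?thesis
    by (intro continuous_intros) auto
qed

lemma logterm_eq: "logterm p = (\<lambda>t. \<bar>t\<bar> powr p * ln (t\<^sup>2))"
  by (auto simp: logterm_def)

lemma fnl_eq: "fnl p = (\<lambda>t. \<bar>t\<bar> powr (p - 2) * ln (t\<^sup>2) * t)"
  by (auto simp: fnl_def)

lemma continuous_logterm: "p > 0 \<Longrightarrow> isCont (logterm p) t"
  unfolding logterm_eq by (rule isCont_abs_powr_ln)

lemma continuous_fnl: "p > 2 \<Longrightarrow> isCont (fnl p) t"
  unfolding fnl_eq by (intro continuous_mult continuous_ident isCont_abs_powr_ln) auto

lemma abs_powr_split2: "\<bar>t\<bar> powr p = \<bar>t\<bar> powr (p - 2) * t\<^sup>2" for t p :: real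
proof (cases "t = 0")
  case False
  then show ?thesis
    by (simp add: powr_diff)
qed auto

lemma fnl_times_self: "fnl p t * t = logterm p t"
  using abs_powr_split2[of t p] by (simp add: fnl_eq logterm_eq power2_eq_square)

text \<open>The quotient |t|^(p-2) log t^2 extends continuously to 0 because p > 2, hence is bounded
  on [-B, B]. Bounds on bounded ranges suffice because finite-energy functions on the lattice are
  bounded.\<close>

lemma nonlinearity_bounds:
  fixes p B :: real
  assumes "p > 2"
  obtains C where "C > 0" "\<And>t. \<bar>t\<bar> \<le> B \<Longrightarrow> \<bar>logterm p t\<bar> \<le> C * t\<^sup>2"
    "\<And>t. \<bar>t\<bar> \<le> B \<Longrightarrow> \<bar>fnl p t\<bar> \<le> C * \<bar>t\<bar>" "\<And>t. \<bar>t\<bar> \<le> B \<Longrightarrow> \<bar>t\<bar> powr p \<le> C * t\<^sup>2"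
proof -
  have "compact ((\<lambda>t. \<bar>t\<bar> powr (p - 2) * ln (t\<^sup>2)) ` {-B..B})"
    using assms by (intro compact_continuous_image continuous_at_imp_continuous_on ballI isCont_abs_powr_ln) auto
  then obtain C where C: "C > 0" "\<And>t. t \<in> {-B..B} \<Longrightarrow> \<bar>\<bar>t\<bar> powr (p - 2) * ln (t\<^sup>2)\<bar> \<le> C"
    by (metis (no_types, lifting) bounded_pos compact_imp_bounded image_eqI real_norm_def)
  show ?thesis
  proof (rule that[of "C + \<bar>B\<bar> powr (p - 2)"])
    show "C + \<bar>B\<bar> powr (p - 2) > 0"
      using C(1) by (simp add: add_pos_nonneg)
    fix t :: real assume t: "\<bar>t\<bar> \<le> B"
    then have *: "\<bar>\<bar>t\<bar> powr (p - 2) * ln (t\<^sup>2)\<bar> \<le> C + \<bar>B\<bar> powr (p - 2)"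
      using C(2)[of t] powr_ge_zero[of "\<bar>B\<bar>" "p - 2"] by (smt (verit) atLeastAtMost_iff)
    show "\<bar>fnl p t\<bar> \<le> (C + \<bar>B\<bar> powr (p - 2)) * \<bar>t\<bar>"
      unfolding fnl_eq using mult_right_mono[OF *, of "\<bar>t\<bar>"] by (simp add: abs_mult)
    show "\<bar>logterm p t\<bar> \<le> (C + \<bar>B\<bar> powr (p - 2)) * t\<^sup>2"
      unfolding logterm_eq abs_powr_split2[of t p] using mult_right_mono[OF *, of "t\<^sup>2"]
      by (simp add: abs_mult mult_ac)
    have "\<bar>t\<bar> powr (p - 2) \<le> \<bar>B\<bar> powr (p - 2)"
      using t assms by (intro powr_mono2) auto
    then show "\<bar>t\<bar> powr p \<le> (C + \<bar>B\<bar> powr (p - 2)) * t\<^sup>2"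
      unfolding abs_powr_split2[of t p] using C(1) by (intro mult_right_mono) auto
  qed
qed

lemma logterm_pos_imp: "logterm p t > 0 \<Longrightarrow> \<bar>t\<bar> > 1"
proof (rule ccontr)
  assume *: "logterm p t > 0" "\<not> \<bar>t\<bar> > 1"
  then have "t\<^sup>2 \<le> 1" by (simp add: abs_square_le_1)
  then have "ln (t\<^sup>2) \<le> 0" by (cases "t = 0") (auto simp: ln_le_zero_iff)
  with * show False by (auto simp: logterm_eq mult_nonneg_nonpos not_less zero_less_mult_iff)
qed

text \<open>This is the integrand of the nonlinear part of J. The term with 2/p^2 cancels what
  differentiating the logarithm leaves behind.\<close>

lemma powr_logterm_deriv:
  fixes t p :: real
  assumes "t \<noteq> 0" "p > 0"
  shows "((\<lambda>t. 2 / p\<^sup>2 * \<bar>t\<bar> powr p - 1 / p * logterm p t) has_real_derivative - fnl p t) (at t)"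
proof -
  have pos: "((\<lambda>t. 2 / p\<^sup>2 * \<bar>t\<bar> powr p - 1 / p * logterm p t) has_real_derivative - fnl p t) (at t)"
    if "t > 0" for t
  proof -
    have "((\<lambda>t. 2 / p\<^sup>2 * t powr p - 1 / p * (t powr p * (2 * ln t))) has_real_derivative
        - (t powr (p - 1) * (2 * ln t))) (at t)"
      using that assms(2)
      by (auto intro!: derivative_eq_intros simp: field_simps power2_eq_square powr_diff)
    moreover have "- (t powr (p - 1) * (2 * ln t)) = - fnl p t"
      using that by (simp add: fnl_eq ln_realpow powr_diff) (simp add: power2_eq_square)
    moreover have "eventually (\<lambda>t. 2 / p\<^sup>2 * t powr p - 1 / p * (t powr p * (2 * ln t))
        = 2 / p\<^sup>2 * \<bar>t\<bar> powr p - 1 / p * logterm p t) (nhds t)"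
      using eventually_nhds_in_open[of "{0<..}" t] that
      by (auto elim!: eventually_mono simp: logterm_eq ln_realpow)
    ultimately show ?thesis
      by (simp add: DERIV_cong_ev)
  qed
  show ?thesis
  proof (cases "t > 0")
    case False
    with assms have "- t > 0" by auto
    from DERIV_mirror[THEN iffD1, OF pos[OF this]]
    have "((\<lambda>t. 2 / p\<^sup>2 * \<bar>t\<bar> powr p - 1 / p * logterm p t) has_real_derivative fnl p (- t)) (at t)"
      by (simp add: logterm_minus minus_equation_iff)
    moreover have "fnl p (- t) = - fnl p t" by (simp add: fnl_def)
    ultimately show ?thesis by simp
  qed (use pos in auto)
qed

section \<open>The energy on a two-parameter fibre\<close>

text \<open>Weighted AM-GM for s^p, t^p and 1 with weights i/p, j/p and 1 - (i+j)/p. The right-hand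
  side is the tangent at (1,1) of s^i t^j as a function of s^p and t^p.\<close>

lemma monomial_le_pos:
  fixes p s t :: real
  assumes "p > 0" "real (i + j) \<le> p" "s > 0" "t > 0"
  shows "s ^ i * t ^ j \<le> 1 + real i * ((s powr p - 1) / p) + real j * ((t powr p - 1) / p)"
proof -
  define m where "m = real i * ln s + real j * ln t"
  have m: "s ^ i * t ^ j = exp m"
    using assms by (simp add: m_def exp_add exp_of_nat_mult)
  \<comment> \<open>The tangent to exp at the weighted mean m. In the weighted sum of the three
    instances the linear terms cancel, which is Jensen's inequality.\<close>
  have tangent: "exp m * (1 + (x - m)) \<le> exp x" for x
  proof -
    have "exp m * (1 + (x - m)) \<le> exp m * exp (x - m)"
      by (intro mult_left_mono exp_ge_add_one_self) auto
    also have "\<dots> = exp x" by (simp flip: exp_add)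
    finally show ?thesis .
  qed
  have "(real i / p) * (exp m * (1 + (p * ln s - m))) + (real j / p) * (exp m * (1 + (p * ln t - m)))
      + (1 - (real i + real j) / p) * (exp m * (1 + (0 - m)))
      \<le> (real i / p) * exp (p * ln s) + (real j / p) * exp (p * ln t) + (1 - (real i + real j) / p) * exp 0"
    using assms by (intro add_mono mult_left_mono tangent) (auto simp: field_simps)
  moreover have "(real i / p) * (exp m * (1 + (p * ln s - m))) + (real j / p) * (exp m * (1 + (p * ln t - m)))
      + (1 - (real i + real j) / p) * (exp m * (1 + (0 - m))) = exp m"
    using assms by (simp add: field_simps) (simp add: m_def field_simps)
  moreover have "s powr p = exp (p * ln s)" "t powr p = exp (p * ln t)"
    using assms by (auto simp: powr_def)
  moreover have "1 + real i * ((x - 1) / p) + real j * ((y - 1) / p)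
      = (real i / p) * x + (real j / p) * y + (1 - (real i + real j) / p) * exp 0" for x y
    using assms by (simp add: field_simps)
  ultimately show ?thesis
    unfolding m by metis
qed

text \<open>The logarithms used before need s, t > 0; the boundary is reached by letting e tend to 0
  in s + e, t + e.\<close>

lemma monomial_le:
  fixes p s t :: real
  assumes p: "p > 0" "real (i + j) \<le> p" and st: "s \<ge> 0" "t \<ge> 0"
  shows "s ^ i * t ^ j \<le> 1 + real i * ((s powr p - 1) / p) + real j * ((t powr p - 1) / p)"
proof (rule tendsto_le[OF trivial_limit_at_right_real[of 0]])
  have ev: "eventually (\<lambda>e. e > 0) (at_right (0::real))"
    by (simp add: eventually_at_filter)
  show "eventually (\<lambda>e. (s + e) ^ i * (t + e) ^ j
      \<le> 1 + real i * (((s + e) powr p - 1) / p) + real j * (((t + e) powr p - 1) / p)) (at_right (0::real))"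
    using ev by eventually_elim (use assms in \<open>intro monomial_le_pos; auto\<close>)
  have lim: "((\<lambda>e. x + e) \<longlongrightarrow> x) (at_right 0)" for x :: real
    by (rule tendsto_eq_intros refl | simp)+
  have lim': "((\<lambda>e. (x + e) powr p) \<longlongrightarrow> x powr p) (at_right 0)" if "x \<ge> 0" for x :: real
    using p(1) that by (intro tendsto_powr2[OF lim]) (auto simp: eventually_at_filter)
  show "((\<lambda>e. (s + e) ^ i * (t + e) ^ j) \<longlongrightarrow> s ^ i * t ^ j) (at_right 0)"
    by (intro tendsto_intros lim)
  show "((\<lambda>e. 1 + real i * (((s + e) powr p - 1) / p) + real j * (((t + e) powr p - 1) / p))
      \<longlongrightarrow> 1 + real i * ((s powr p - 1) / p) + real j * ((t powr p - 1) / p)) (at_right 0)"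
    using p(1) by (intro tendsto_intros lim' st) auto
qed

text \<open>With r = s^p this is r ln r - r + 1, the distance of the strictly convex function r ln r
  from its tangent at 1.\<close>

definition entropy_gap :: "real \<Rightarrow> real \<Rightarrow> real" where
  "entropy_gap p s = p / 2 * logterm p s - s powr p + 1"

lemma entropy_gap_pos:
  assumes "p > 0" "s \<ge> 0" "s \<noteq> 1"
  shows "entropy_gap p s > 0"
proof (cases "s = 0")
  case True
  then show ?thesis by (simp add: entropy_gap_def logterm_def)
next
  case False
  define r where "r = s powr p"
  have r: "r > 0" "r \<noteq> 1" "ln r = p * ln s"
    using assms False by (auto simp: r_def powr_eq_one_iff_gen ln_powr)
  have "ln (1 / r) < 1 / r - 1"
    using r ln_le_minus_one[of "1 / r"] ln_eq_minus_one[of "1 / r"] by fastforce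
  then have "r - 1 < r * ln r"
    using r by (simp add: ln_div field_simps)
  moreover have "entropy_gap p s = r * ln r - r + 1"
    using assms False by (simp add: entropy_gap_def logterm_def r_def ln_powr ln_realpow)
  ultimately show ?thesis by simp
qed

lemma entropy_gap_1: "entropy_gap p 1 = 0"
  by (simp add: entropy_gap_def logterm_def)

lemma entropy_gap_nonneg: "p > 0 \<Longrightarrow> s \<ge> 0 \<Longrightarrow> entropy_gap p s \<ge> 0"
  by (cases "s = 1") (auto simp: entropy_gap_1 dest: entropy_gap_pos intro: less_imp_le)

text \<open>Collects the tangent bounds: the coefficients of x and y are the residuals
  \<open>R1 1 1\<close> and \<open>R2 1 1\<close> of the fibre. The premises with factors 2 and 4
  allow an application to a/2, b/4 and half potentials, so that \<open>algebra\<close> meets no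
  division.\<close>

lemma tangent_ring_identity:
  fixes a b V1 V2 G1 K G2 x y q1 q2 L1 L2 e1 e2 :: real
  assumes "c = 2 * a" "d = 4 * b" "V = 2 * V1" "W = 2 * V2"
  shows "a * ((1 + 2 * x) * G1 + 2 * ((1 + x + y) * K) + (1 + 2 * y) * G2)
     + ((1 + 2 * x) * V1 + (1 + 2 * y) * V2) + b * ((1 + 4 * x) * G1\<^sup>2 + (1 + 3 * x + y) * (4 * (G1 * K))
      + (1 + 2 * x + 2 * y) * (4 * K\<^sup>2 + 2 * (G1 * G2)) + (1 + x + 3 * y) * (4 * (K * G2)) + (1 + 4 * y) * G2\<^sup>2)
     + (q1 - x * L1 - e1) + (q2 - y * L2 - e2)
   = a * (G1 + 2 * K + G2) + (V1 + V2) + b * (G1 + 2 * K + G2)\<^sup>2 + q1 + q2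
     + x * ((c + d * (G1 + 2 * K + G2)) * (G1 + K) + V - L1)
     + y * ((c + d * (G1 + 2 * K + G2)) * (K + G2) + W - L2) - (e1 + e2)"
  unfolding assms by algebra

text \<open>The numbers that determine J on the fibre of v: G1, K, G2 are the values of the gradient
  form on v^+ and v^-, the V are potential energies, the P are l^p sums, and the L are logarithmic
  sums, whose sign is free. K is minus half the interaction sum of v^+ and v^-.\<close>

locale fibre =
  fixes a b p G1 K G2 V1 V2 P1 P2 L1 L2 :: real
  assumes a: "a > 0" and b: "b > 0" and p: "p > 4"
    and G1: "G1 \<ge> 0" and K: "K \<ge> 0" and G2: "G2 \<ge> 0"
    and V1: "V1 > 0" and V2: "V2 > 0" and P1: "P1 > 0" and P2: "P2 > 0"
begin

definition G where "G s t = s\<^sup>2 * G1 + 2 * s * t * K + t\<^sup>2 * G2"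

definition psi where
  "psi P L s = 2 / p\<^sup>2 * (P * s powr p) - 1 / p * (s powr p * L + P * logterm p s)"

text \<open>The energy of s v^+ + t v^- for s, t >= 0.\<close>

definition N where
  "N s t = a / 2 * G s t + (s\<^sup>2 * V1 + t\<^sup>2 * V2) / 2 + b / 4 * (G s t)\<^sup>2 + psi P1 L1 s + psi P2 L2 t"

text \<open>The derivative of J at s v^+ + t v^-, tested with s v^+; it equals s times the partial
  derivative of \<open>N\<close> in s. \<open>R2\<close> is the same for t v^-, so for s, t > 0 the
  Nehari set is where both vanish.\<close>

definition R1 where
  "R1 s t = (a + b * G s t) * (s\<^sup>2 * G1 + s * t * K) + s\<^sup>2 * V1 - (s powr p * L1 + P1 * logterm p s)"

definition R2 where
  "R2 s t = (a + b * G s t) * (s * t * K + t\<^sup>2 * G2) + t\<^sup>2 * V2 - (t powr p * L2 + P2 * logterm p t)"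

text \<open>In the variable s^p the nonlinear part is affine minus a multiple of r ln r; removing
  the tangent at 1 leaves the entropy gap.\<close>

lemma psi_eq:
  "psi P L s = psi P L 1 - (s powr p - 1) / p * L - 2 / p\<^sup>2 * (P * entropy_gap p s)"
  using p by (simp add: psi_def entropy_gap_def logterm_def[of p 1] field_simps power2_eq_square)

text \<open>In the variables \<open>s powr p\<close> and \<open>t powr p\<close> the map \<open>N\<close> is concave, since \<open>p > 4\<close>;
  this is its tangent inequality at \<open>(1, 1)\<close>.\<close>

lemma N_le_tangent:
  assumes "s \<ge> 0" "t \<ge> 0"
  shows "N s t \<le> N 1 1 + (s powr p - 1) / p * R1 1 1 + (t powr p - 1) / p * R2 1 1
     - 2 / p\<^sup>2 * (P1 * entropy_gap p s + P2 * entropy_gap p t)"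
proof -
  \<comment> \<open>Normalised so that the tangent of s^i t^j at (1,1) is 1 + i x + j y.\<close>
  define x y where "x = (s powr p - 1) / p" and "y = (t powr p - 1) / p"
  have m: "s ^ i * t ^ j \<le> 1 + real i * x + real j * y" if "i + j \<le> 4" for i j
    unfolding x_def y_def using p that assms by (intro monomial_le) linarith+
  have m2: "s\<^sup>2 \<le> 1 + 2 * x" "t\<^sup>2 \<le> 1 + 2 * y" "s * t \<le> 1 + x + y"
    using m[of 2 0] m[of 0 2] m[of 1 1] by auto
  have m4: "s ^ 4 \<le> 1 + 4 * x" "s ^ 3 * t \<le> 1 + 3 * x + y" "s\<^sup>2 * t\<^sup>2 \<le> 1 + 2 * x + 2 * y"
    "s * t ^ 3 \<le> 1 + x + 3 * y" "t ^ 4 \<le> 1 + 4 * y"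
    using m[of 4 0] m[of 3 1] m[of 2 2] m[of 1 3] m[of 0 4] by auto
  have g: "G s t \<le> (1 + 2 * x) * G1 + 2 * ((1 + x + y) * K) + (1 + 2 * y) * G2"
  proof -
    have "G s t = s\<^sup>2 * G1 + 2 * ((s * t) * K) + t\<^sup>2 * G2" by (simp add: G_def)
    also have "\<dots> \<le> (1 + 2 * x) * G1 + 2 * ((1 + x + y) * K) + (1 + 2 * y) * G2"
      using G1 K G2 by (intro add_mono mult_left_mono mult_right_mono m2) auto
    finally show ?thesis .
  qed
  have g2: "(G s t)\<^sup>2 \<le> (1 + 4 * x) * G1\<^sup>2 + (1 + 3 * x + y) * (4 * (G1 * K))
      + (1 + 2 * x + 2 * y) * (4 * K\<^sup>2 + 2 * (G1 * G2)) + (1 + x + 3 * y) * (4 * (K * G2)) + (1 + 4 * y) * G2\<^sup>2"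
  proof -
    have "(G s t)\<^sup>2 = s ^ 4 * G1\<^sup>2 + (s ^ 3 * t) * (4 * (G1 * K))
      + (s\<^sup>2 * t\<^sup>2) * (4 * K\<^sup>2 + 2 * (G1 * G2)) + (s * t ^ 3) * (4 * (K * G2)) + t ^ 4 * G2\<^sup>2"
      by (simp add: G_def algebra_simps power2_eq_square power3_eq_cube power4_eq_xxxx)
    also have "\<dots> \<le> (1 + 4 * x) * G1\<^sup>2 + (1 + 3 * x + y) * (4 * (G1 * K))
      + (1 + 2 * x + 2 * y) * (4 * K\<^sup>2 + 2 * (G1 * G2)) + (1 + x + 3 * y) * (4 * (K * G2)) + (1 + 4 * y) * G2\<^sup>2"
      using G1 K G2 by (intro add_mono mult_right_mono m4) auto
    finally show ?thesis .
  qed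
  have v: "s\<^sup>2 * V1 + t\<^sup>2 * V2 \<le> (1 + 2 * x) * V1 + (1 + 2 * y) * V2"
    using V1 V2 by (intro add_mono mult_right_mono m2) auto
  \<comment> \<open>Every monomial has a nonnegative coefficient, the mixed ones because K >= 0, so
    the tangent bounds may be inserted term by term.\<close>
  have "N s t \<le> a / 2 * ((1 + 2 * x) * G1 + 2 * ((1 + x + y) * K) + (1 + 2 * y) * G2)
     + ((1 + 2 * x) * V1 + (1 + 2 * y) * V2) / 2 + b / 4 * ((1 + 4 * x) * G1\<^sup>2 + (1 + 3 * x + y) * (4 * (G1 * K))
      + (1 + 2 * x + 2 * y) * (4 * K\<^sup>2 + 2 * (G1 * G2)) + (1 + x + 3 * y) * (4 * (K * G2)) + (1 + 4 * y) * G2\<^sup>2)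
     + psi P1 L1 s + psi P2 L2 t"
    unfolding N_def using a b by (intro add_mono mult_left_mono divide_right_mono g g2 v) auto
  also have "\<dots> = a / 2 * (G1 + 2 * K + G2) + (V1 / 2 + V2 / 2) + b / 4 * (G1 + 2 * K + G2)\<^sup>2
     + psi P1 L1 1 + psi P2 L2 1
     + x * ((a + b * (G1 + 2 * K + G2)) * (G1 + K) + V1 - L1)
     + y * ((a + b * (G1 + 2 * K + G2)) * (K + G2) + V2 - L2)
     - (2 / p\<^sup>2 * (P1 * entropy_gap p s) + 2 / p\<^sup>2 * (P2 * entropy_gap p t))"
    unfolding psi_eq[of P1 L1 s] psi_eq[of P2 L2 t] x_def[symmetric] y_def[symmetric]
      add_divide_distrib times_divide_eq_right[symmetric] by (rule tangent_ring_identity) auto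
  also have "\<dots> = N 1 1 + x * R1 1 1 + y * R2 1 1
     - 2 / p\<^sup>2 * (P1 * entropy_gap p s + P2 * entropy_gap p t)"
    by (simp add: N_def R1_def R2_def G_def logterm_def[of p 1] distrib_left add_divide_distrib)
  finally show ?thesis by (simp add: x_def y_def)
qed

section \<open>Continuity, critical points and maxima of the fibre energy\<close>

lemma continuous_psi: "continuous_on {0..} (psi P L)"
  unfolding psi_def using p
  by (intro continuous_intros continuous_on_powr' continuous_at_imp_continuous_on[of _ "logterm p"]
      ballI continuous_logterm) auto

lemma continuous_N: "continuous_on ({0..} \<times> {0..}) (\<lambda>z. N (fst z) (snd z))"
  unfolding N_def G_def
  by (intro continuous_intros continuous_on_compose2[OF continuous_psi]) auto

lemma psi_deriv:
  assumes "s > 0"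
  shows "(psi P L has_real_derivative - ((s powr p * L + P * logterm p s) / s)) (at s)"
proof -
  have d: "((\<lambda>s. P * (2 / p\<^sup>2 * \<bar>s\<bar> powr p - 1 / p * logterm p s) - L / p * s powr p)
      has_real_derivative P * (- fnl p s) - L / p * (p * s powr (p - 1))) (at s)"
    using assms p by (intro DERIV_diff DERIV_cmult powr_logterm_deriv has_real_derivative_powr) auto
  have eq: "P * (2 / p\<^sup>2 * \<bar>x\<bar> powr p - 1 / p * logterm p x) - L / p * x powr p = psi P L x"
    if "x \<in> {0<..}" for x
    using that by (simp add: psi_def right_diff_distrib distrib_left mult_ac)
  have "P * (- fnl p s) - L / p * (p * s powr (p - 1)) = - ((s powr p * L + P * (fnl p s * s)) / s)"
    using assms p by (simp add: powr_diff add_divide_distrib)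
  then have "P * (- fnl p s) - L / p * (p * s powr (p - 1)) = - ((s powr p * L + P * logterm p s) / s)"
    by (simp add: fnl_times_self)
  with has_field_derivative_transform_within_open[OF d open_greaterThan _ eq] show ?thesis
    using assms by (metis greaterThan_iff)
qed

text \<open>The partial derivatives of \<open>N\<close> are R1/s and R2/t. Only a local maximum is
  required, so that the lemma serves both the global maximum on a fibre and a maximum over a small
  square.\<close>

lemma N_local_max_imp:
  assumes st: "s > 0" "t > 0" and d: "d > 0"
    and max: "\<And>s' t'. \<bar>s - s'\<bar> < d \<Longrightarrow> \<bar>t - t'\<bar> < d \<Longrightarrow> N s' t' \<le> N s t"
  shows "R1 s t = 0" "R2 s t = 0"
proof -
  have "((\<lambda>s. N s t) has_real_derivative R1 s t / s) (at s)"
  proof -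
    have "((\<lambda>s. N s t) has_real_derivative
        a / 2 * (2 * s * G1 + 2 * t * K) + s * V1 + b / 4 * (2 * G s t * (2 * s * G1 + 2 * t * K))
        + - ((s powr p * L1 + P1 * logterm p s) / s)) (at s)"
      unfolding N_def G_def by (auto intro!: derivative_eq_intros psi_deriv st)
    then show ?thesis
      using st by (simp add: R1_def add_divide_distrib diff_divide_distrib algebra_simps power2_eq_square)
  qed
  from DERIV_local_max[OF this d] max[of _ t] d have "R1 s t / s = 0" by auto
  then show "R1 s t = 0" using st by simp
  have "((\<lambda>t. N s t) has_real_derivative R2 s t / t) (at t)"
  proof -
    have "((\<lambda>t. N s t) has_real_derivative
        a / 2 * (2 * s * K + 2 * t * G2) + t * V2 + b / 4 * (2 * G s t * (2 * s * K + 2 * t * G2))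
        + - ((t powr p * L2 + P2 * logterm p t) / t)) (at t)"
      unfolding N_def G_def by (auto intro!: derivative_eq_intros psi_deriv st)
    then show ?thesis
      using st by (simp add: R2_def add_divide_distrib diff_divide_distrib algebra_simps power2_eq_square)
  qed
  from DERIV_local_max[OF this d] max[of s] d have "R2 s t / t = 0" by auto
  then show "R2 s t = 0" using st by simp
qed

text \<open>The leading term is - (2 P / p) s^p ln s. It beats s^4 because p > 4, and s^p L because
  of the logarithm.\<close>

lemma coercive_aux:
  assumes "P > 0"
  shows "filterlim (\<lambda>s. A * s\<^sup>2 + B * s ^ 4 + psi P L s) at_bot at_top"
proof -
  have "filterlim (\<lambda>s. A * s\<^sup>2 + B * s ^ 4 + (2 / p\<^sup>2 * (P * s powr p) - 1 / p * (s powr p * L + P * (s powr p * (2 * ln s))))) at_bot at_top"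
    using assms p by real_asymp
  moreover have "eventually (\<lambda>s. A * s\<^sup>2 + B * s ^ 4 + (2 / p\<^sup>2 * (P * s powr p) - 1 / p * (s powr p * L + P * (s powr p * (2 * ln s))))
      = A * s\<^sup>2 + B * s ^ 4 + psi P L s) at_top"
    using eventually_gt_at_top[of 0]
    by eventually_elim (simp add: psi_def logterm_def ln_realpow)
  ultimately show ?thesis by (rule filterlim_mono_eventually[OF _ order_refl order_refl])
qed

text \<open>Near 0 the quadratic term dominates s^p and s^p ln s. This keeps maximum points of
  \<open>N\<close> off the axes.\<close>

lemma positive_near_0:
  assumes "V > 0"
  obtains s where "s > 0" "s\<^sup>2 * V / 2 + psi P L s > 0"
proof -
  have "eventually (\<lambda>s. s\<^sup>2 * V / 2 + (2 / p\<^sup>2 * (P * s powr p) - 1 / p * (s powr p * L + P * (s powr p * (2 * ln s)))) > 0) (at_right 0)"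
    using assms p by real_asymp
  moreover have "eventually (\<lambda>s::real. s > 0) (at_right 0)"
    by (simp add: eventually_at_filter)
  ultimately have "eventually (\<lambda>s. s > 0 \<and> s\<^sup>2 * V / 2 + psi P L s > 0) (at_right 0)"
    by eventually_elim (simp add: psi_def logterm_def ln_realpow)
  then show ?thesis
    using that eventually_happens'[OF trivial_limit_at_right_real] by blast
qed

text \<open>When both residuals vanish the tangent plane is horizontal, and the entropy gap measures
  the loss away from (1,1).\<close>

lemma N_le_on_M:
  assumes "R1 1 1 = 0" "R2 1 1 = 0" "s \<ge> 0" "t \<ge> 0"
  shows "N s t \<le> N 1 1" and "(s, t) \<noteq> (1, 1) \<Longrightarrow> N s t < N 1 1"
proof -
  have *: "N s t \<le> N 1 1 - 2 / p\<^sup>2 * (P1 * entropy_gap p s + P2 * entropy_gap p t)"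
    using N_le_tangent[of s t] assms by simp
  have n: "P1 * entropy_gap p s \<ge> 0" "P2 * entropy_gap p t \<ge> 0"
    using assms P1 P2 p by (auto intro!: mult_nonneg_nonneg entropy_gap_nonneg)
  then have "2 / p\<^sup>2 * (P1 * entropy_gap p s + P2 * entropy_gap p t) \<ge> 0"
    by simp
  with * show "N s t \<le> N 1 1" by linarith
  assume "(s, t) \<noteq> (1, 1)"
  then have "P1 * entropy_gap p s + P2 * entropy_gap p t > 0"
    using n P1 P2 p assms entropy_gap_pos[of p s] entropy_gap_pos[of p t]
    by (cases "s = 1") (auto intro: add_nonneg_pos add_pos_nonneg)
  then have "2 / p\<^sup>2 * (P1 * entropy_gap p s + P2 * entropy_gap p t) > 0"
    using p by simp
  with * show "N s t < N 1 1" by linarith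
qed

lemma bounded_above_aux:
  assumes "P > 0" "A \<ge> 0" "B \<ge> 0"
  obtains M where "M \<ge> 0" "\<And>s. s \<ge> 0 \<Longrightarrow> A * s\<^sup>2 + B * s ^ 4 + psi P L s \<le> M"
proof -
  obtain r where r: "\<And>s. s \<ge> r \<Longrightarrow> A * s\<^sup>2 + B * s ^ 4 + psi P L s \<le> 0"
    using coercive_aux[OF assms(1), of A B L]
    unfolding filterlim_at_bot eventually_at_top_linorder by blast
  have "compact ((\<lambda>s. A * s\<^sup>2 + B * s ^ 4 + psi P L s) ` {0..max r 0})"
    by (intro compact_continuous_image continuous_intros continuous_on_subset[OF continuous_psi]) auto
  then obtain M where M: "\<And>s. s \<in> {0..max r 0} \<Longrightarrow> \<bar>A * s\<^sup>2 + B * s ^ 4 + psi P L s\<bar> \<le> M"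
    by (metis (no_types, lifting) bounded_iff compact_imp_bounded image_eqI real_norm_def)
  show ?thesis
  proof (rule that[of "max M 0"])
    fix s :: real assume "s \<ge> 0"
    then show "A * s\<^sup>2 + B * s ^ 4 + psi P L s \<le> max M 0"
      using r[of s] M[of s] by (cases "s \<ge> r") auto
  qed auto
qed

text \<open>By 2 s t <= s^2 + t^2 the mixed terms are absorbed, and \<open>N\<close> is bounded by a
  sum of two coercive one-variable functions. A maximum over a large square is then one over the
  whole quadrant.\<close>

lemma N_attains_max:
  obtains s t where "s > 0" "t > 0" "\<And>s' t'. s' \<ge> 0 \<Longrightarrow> t' \<ge> 0 \<Longrightarrow> N s' t' \<le> N s t"
proof -
  define m where "m = G1 + K + G2"
  \<comment> \<open>\<open>B\<close> carries b/2 where \<open>N\<close> has b/4: splitting (s^2 +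
    t^2)^2 into s^4 + t^4 costs a factor 2.\<close>
  define A1 A2 B where "A1 = a / 2 * m + V1 / 2" and "A2 = a / 2 * m + V2 / 2" and "B = b / 2 * m\<^sup>2"
  have m: "m \<ge> 0" using G1 K G2 by (simp add: m_def)
  have AB: "A1 \<ge> 0" "A2 \<ge> 0" "B \<ge> 0"
    using m a b V1 V2 by (auto simp: A1_def A2_def B_def)
  have Gbd: "G s t \<le> m * (s\<^sup>2 + t\<^sup>2)" for s t
  proof -
    have "G s t \<le> s\<^sup>2 * G1 + (s\<^sup>2 + t\<^sup>2) * K + t\<^sup>2 * G2"
      unfolding G_def using K sum_squares_bound[of s t] by (intro add_mono mult_right_mono order_refl) auto
    also have "\<dots> \<le> m * (s\<^sup>2 + t\<^sup>2)"
      using G1 G2 by (simp add: m_def algebra_simps)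
    finally show ?thesis .
  qed
  have Nbd: "N s t \<le> (A1 * s\<^sup>2 + B * s ^ 4 + psi P1 L1 s) + (A2 * t\<^sup>2 + B * t ^ 4 + psi P2 L2 t)"
    if "s \<ge> 0" "t \<ge> 0" for s t
  proof -
    have "(G s t)\<^sup>2 \<le> (m * (s\<^sup>2 + t\<^sup>2))\<^sup>2"
      using that G1 K G2 by (intro power_mono Gbd) (auto simp: G_def)
    also have "\<dots> \<le> m\<^sup>2 * (2 * (s ^ 4 + t ^ 4))"
      unfolding power_mult_distrib using sum_squares_bound[of "s\<^sup>2" "t\<^sup>2"]
      by (intro mult_left_mono) (auto simp: power2_sum)
    finally have "N s t \<le> a / 2 * (m * (s\<^sup>2 + t\<^sup>2)) + (s\<^sup>2 * V1 + t\<^sup>2 * V2) / 2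
        + b / 4 * (m\<^sup>2 * (2 * (s ^ 4 + t ^ 4))) + psi P1 L1 s + psi P2 L2 t"
      unfolding N_def using a b Gbd[of s t] by (intro add_mono mult_left_mono) auto
    also have "\<dots> = (A1 * s\<^sup>2 + B * s ^ 4 + psi P1 L1 s) + (A2 * t\<^sup>2 + B * t ^ 4 + psi P2 L2 t)"
      by (simp add: A1_def A2_def B_def field_simps)
    finally show ?thesis .
  qed
  obtain M1 where M1: "M1 \<ge> 0" "\<And>s. s \<ge> 0 \<Longrightarrow> A1 * s\<^sup>2 + B * s ^ 4 + psi P1 L1 s \<le> M1"
    using bounded_above_aux[OF P1 AB(1,3)] by blast
  obtain M2 where M2: "M2 \<ge> 0" "\<And>s. s \<ge> 0 \<Longrightarrow> A2 * s\<^sup>2 + B * s ^ 4 + psi P2 L2 s \<le> M2"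
    using bounded_above_aux[OF P2 AB(2,3)] by blast
  \<comment> \<open>The levels - M2 and - M1 are chosen so that one large coordinate alone makes the
    bound at most 0 = \<open>N 0 0\<close>.\<close>
  obtain r1 where r1: "\<And>s. s \<ge> r1 \<Longrightarrow> A1 * s\<^sup>2 + B * s ^ 4 + psi P1 L1 s \<le> - M2"
    using coercive_aux[OF P1, of A1 B L1] unfolding filterlim_at_bot eventually_at_top_linorder by blast
  obtain r2 where r2: "\<And>s. s \<ge> r2 \<Longrightarrow> A2 * s\<^sup>2 + B * s ^ 4 + psi P2 L2 s \<le> - M1"
    using coercive_aux[OF P2, of A2 B L2] unfolding filterlim_at_bot eventually_at_top_linorder by blast
  define r where "r = max 0 (max r1 r2)"
  have N00: "N 0 0 = 0" by (simp add: N_def G_def psi_def logterm_def)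
  have "compact ({0..r} \<times> {0..r})" "{0..r} \<times> {0..r} \<noteq> {}"
    by (auto intro: compact_Times simp: r_def)
  moreover have "{0..r} \<times> {0..r} \<subseteq> {0..} \<times> {0..}"
    by auto
  ultimately obtain z where "z \<in> {0..r} \<times> {0..r}"
      "\<forall>y\<in>{0..r} \<times> {0..r}. N (fst y) (snd y) \<le> N (fst z) (snd z)"
    using continuous_attains_sup[OF _ _ continuous_on_subset[OF continuous_N]] by metis
  then obtain s t where st: "s \<ge> 0" "t \<ge> 0"
    and box: "\<And>s' t'. s' \<in> {0..r} \<Longrightarrow> t' \<in> {0..r} \<Longrightarrow> N s' t' \<le> N s t"
    by (cases z) fastforce
  have max: "N s' t' \<le> N s t" if "s' \<ge> 0" "t' \<ge> 0" for s' t'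
  proof (cases "s' \<le> r \<and> t' \<le> r")
    case False
    then have "s' \<ge> r1 \<or> t' \<ge> r2" by (auto simp: r_def)
    then have "N s' t' \<le> 0"
      using Nbd[OF that] r1[of s'] r2[of t'] M1(2)[of s'] M2(2)[of t'] that by linarith
    also have "0 \<le> N s t" using box[of 0 0] by (simp add: N00 r_def)
    finally show ?thesis .
  qed (use box that in auto)
  \<comment> \<open>Moving off the axis does not decrease \<open>G\<close> and adds a positive
    one-variable term, against maximality.\<close>
  have "s \<noteq> 0"
  proof
    assume "s = 0"
    obtain e where e: "e > 0" "e\<^sup>2 * V1 / 2 + psi P1 L1 e > 0"
      using positive_near_0[OF V1] by blast
    have "G e t \<ge> G 0 t" "G 0 t \<ge> 0"
      using e st G1 G2 K by (auto simp: G_def)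
    then have "N 0 t + (e\<^sup>2 * V1 / 2 + psi P1 L1 e) \<le> N e t"
      using a b by (simp add: N_def psi_def[of P1 L1 0] logterm_def[of p 0] add_divide_distrib
          add_mono mult_left_mono power_mono)
    with max[of e t] e st \<open>s = 0\<close> show False by auto
  qed
  moreover have "t \<noteq> 0"
  proof
    assume "t = 0"
    obtain e where e: "e > 0" "e\<^sup>2 * V2 / 2 + psi P2 L2 e > 0"
      using positive_near_0[OF V2] by blast
    have "G s e \<ge> G s 0" "G s 0 \<ge> 0"
      using e st G1 G2 K by (auto simp: G_def)
    then have "N s 0 + (e\<^sup>2 * V2 / 2 + psi P2 L2 e) \<le> N s e"
      using a b by (simp add: N_def psi_def[of P2 L2 0] logterm_def[of p 0] add_divide_distrib
          add_mono mult_left_mono power_mono)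
    with max[of s e] e st \<open>t = 0\<close> show False by auto
  qed
  ultimately show ?thesis
    using st by (intro that[of s t] max) auto
qed

end

section \<open>Summability of the weight\<close>

lemma summable_on_int_powr:
  fixes q :: real
  assumes "q > 1"
  shows "(\<lambda>k::int. (1 + \<bar>real_of_int k\<bar>) powr - q) summable_on UNIV"
proof -
  have "summable (\<lambda>n. real (Suc n) powr - q)"
    using assms by (subst summable_Suc_iff) (simp add: summable_real_powr_iff)
  then have *: "(\<lambda>n::nat. (1 + real n) powr - q) summable_on UNIV"
    by (subst summable_on_UNIV_nonneg_real_iff) (auto simp: add.commute)
  have "(\<lambda>k::int. (1 + \<bar>real_of_int k\<bar>) powr - q) summable_on range int"
    using * by (subst summable_on_reindex) (auto simp: o_def)
  moreover have "(\<lambda>k::int. (1 + \<bar>real_of_int k\<bar>) powr - q) summable_on range (\<lambda>n. - int n)"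
    using * by (subst summable_on_reindex) (auto simp: o_def inj_on_def)
  moreover have "range int \<union> range (\<lambda>n. - int n) = UNIV"
    by (auto simp: image_iff) (metis int_cases2)
  ultimately show ?thesis
    using summable_on_union by metis
qed

text \<open>Each |z_i| is at most the distance of z to 0, so the function lies below the product of
  (1 + |z_i|)^(-q/d). Since q/d > 1, every factor is summable over the integers.\<close>

lemma summable_on_lattice_powr:
  fixes q :: real
  assumes "q > real CARD('n)"
  shows "(\<lambda>z::int^'n. (1 + real_of_int (ldist z 0)) powr - q) summable_on UNIV"
proof -
  define r where "r = q / real CARD('n)"
  define g where "g k = (1 + \<bar>real_of_int k\<bar>) powr - r" for k :: int
  have r: "r > 1" "q = real CARD('n) * r"
    using assms by (auto simp: r_def)
  have gs: "g summable_on UNIV"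
    unfolding g_def using r by (intro summable_on_int_powr)
  have g0: "g k \<ge> 0" for k by (simp add: g_def)
  have le: "(1 + real_of_int (ldist z 0)) powr - q \<le> (\<Prod>i\<in>UNIV. g (z $ i))" for z :: "int^'n"
  proof -
    have "\<bar>z $ i\<bar> \<le> ldist z 0" for i
      unfolding ldist_def using member_le_sum[of i UNIV "\<lambda>i. \<bar>z $ i\<bar>"] by simp
    then have "(1 + real_of_int (ldist z 0)) powr - r \<le> g (z $ i)" for i
      unfolding g_def using r by (intro powr_mono2') (auto simp flip: of_int_abs)
    then have "(\<Prod>i\<in>(UNIV::'n set). (1 + real_of_int (ldist z 0)) powr - r) \<le> (\<Prod>i\<in>UNIV. g (z $ i))"
      by (intro prod_mono) auto
    moreover have "ldist z 0 \<ge> 0" by (simp add: ldist_def sum_nonneg)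
    ultimately show ?thesis
      by (simp add: r powr_powr mult.commute flip: powr_realpow')
  qed
  have "(\<Sum>z\<in>F. (1 + real_of_int (ldist z 0)) powr - q) \<le> infsum g UNIV ^ CARD('n)"
    if F: "finite F" for F :: "(int^'n) set"
  proof -
    \<comment> \<open>Enlarging \<open>F\<close> to the cube K^d turns the sum of products into a
      product of one-dimensional sums.\<close>
    define K where "K = (\<Union>i. (\<lambda>z. z $ i) ` F)"
    have K: "finite K" using F by (auto simp: K_def)
    have inj: "inj_on vec_nth F" by (auto simp: inj_on_def vec_nth_inject)
    have "(\<Sum>z\<in>F. (1 + real_of_int (ldist z 0)) powr - q) \<le> (\<Sum>z\<in>F. \<Prod>i\<in>UNIV. g (z $ i))"
      by (intro sum_mono le)
    also have "\<dots> = (\<Sum>f\<in>vec_nth ` F. \<Prod>i\<in>UNIV. g (f i))"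
      by (simp add: sum.reindex[OF inj])
    also have "\<dots> \<le> (\<Sum>f\<in>PiE (UNIV::'n set) (\<lambda>_. K). \<Prod>i\<in>UNIV. g (f i))"
      by (intro sum_mono2) (use K in \<open>auto simp: K_def intro!: prod_nonneg g0 finite_PiE\<close>)
    also have "\<dots> = (\<Prod>i\<in>(UNIV::'n set). \<Sum>k\<in>K. g k)"
      using K by (subst prod_sum_PiE) auto
    also have "\<dots> \<le> infsum g UNIV ^ CARD('n)"
      using K by (auto intro!: power_mono sum_nonneg g0 finite_sum_le_infsum gs)
    finally show ?thesis .
  qed
  then show ?thesis
    by (intro nonneg_bdd_above_summable_on bdd_aboveI) auto
qed

text \<open>Every row lies below a translate of one summable function of y - x, which makes the
  bound uniform in x.\<close>

lemma weight_row_sums_bounded: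
  fixes w :: "int^'n \<Rightarrow> int^'n \<Rightarrow> real" and q C :: real
  assumes q: "q > real CARD('n)" and C: "C \<ge> 0"
    and w: "\<And>x y. x \<noteq> y \<Longrightarrow> 0 \<le> w x y \<and> w x y \<le> C * real_of_int (ldist x y) powr - q"
  obtains W where "\<And>x. w x summable_on (UNIV - {x})" "\<And>x. infsum (w x) (UNIV - {x}) \<le> W"
proof -
  define S where "S z = (1 + real_of_int (ldist z 0)) powr - q" for z :: "int^'n"
  have S: "S summable_on UNIV"
    unfolding S_def using q by (rule summable_on_lattice_powr)
  have bij: "bij_betw (\<lambda>y. y - x) UNIV UNIV" for x :: "int^'n"
    by (rule bij_betw_byWitness[of _ "\<lambda>y. y + x"]) auto
  have Sx: "(\<lambda>y. S (y - x)) summable_on UNIV" "infsum (\<lambda>y. S (y - x)) UNIV = infsum S UNIV" for x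
    using S summable_on_reindex_bij_betw[OF bij, of S x] infsum_reindex_bij_betw[OF bij, of S x] by auto
  have le: "w x y \<le> (C * 2 powr q) * S (y - x)" if "x \<noteq> y" for x y
  proof -
    obtain i where "x $ i \<noteq> y $ i" using \<open>x \<noteq> y\<close> by (auto simp: vec_eq_iff)
    then have "1 \<le> \<bar>x $ i - y $ i\<bar>" by auto
    also have "\<dots> \<le> ldist x y"
      unfolding ldist_def by (rule member_le_sum) auto
    finally have d: "1 \<le> real_of_int (ldist x y)" by simp
    \<comment> \<open>Distinct lattice points have distance at least 1, hence at least (1 +
      distance) / 2. This is the origin of the factor 2^q.\<close>
    have "real_of_int (ldist x y) powr - q \<le> ((1 + real_of_int (ldist x y)) / 2) powr - q"
      using d q by (intro powr_mono2') auto
    also have "\<dots> = 2 powr q * (1 + real_of_int (ldist x y)) powr - q"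
      using d by (simp add: powr_divide powr_minus divide_simps)
    also have "ldist x y = ldist (y - x) 0"
      by (simp add: ldist_def abs_minus_commute)
    finally have "real_of_int (ldist x y) powr - q \<le> 2 powr q * S (y - x)"
      by (simp add: S_def ldist_def abs_minus_commute)
    then have "C * real_of_int (ldist x y) powr - q \<le> C * (2 powr q * S (y - x))"
      using C by (rule mult_left_mono)
    with w[OF that] show ?thesis by (simp add: mult.assoc)
  qed
  have Cx: "(\<lambda>y. (C * 2 powr q) * S (y - x)) summable_on A" for x A
    by (rule summable_on_subset_banach[of _ UNIV]) (auto intro: summable_on_cmult_right Sx)
  have sum: "w x summable_on (UNIV - {x})" for x
    by (rule summable_on_comparison_test[OF Cx[of x]]) (use w le in auto)
  moreover have "infsum (w x) (UNIV - {x}) \<le> (C * 2 powr q) * infsum S UNIV" for x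
  proof -
    have "infsum (w x) (UNIV - {x}) \<le> infsum (\<lambda>y. (C * 2 powr q) * S (y - x)) UNIV"
      by (rule infsum_mono_neutral[OF sum Cx[of x]]) (use le C in \<open>auto simp: S_def\<close>)
    then show ?thesis by (simp add: infsum_cmult_right' Sx)
  qed
  ultimately show ?thesis using that by blast
qed

section \<open>Finite balls and sublevel sets of the potential\<close>

lemma finite_ldist_ball: "finite {x::int^'n. real_of_int (ldist x x0) < R}"
proof -
  have "{x. real_of_int (ldist x x0) < R} \<subseteq> {x. \<forall>i. x $ i \<in> {x0 $ i - \<lceil>R\<rceil>..x0 $ i + \<lceil>R\<rceil>}}"
  proof safe
    fix x i assume *: "real_of_int (ldist x x0) < R"
    have "\<bar>x $ i - x0 $ i\<bar> \<le> ldist x x0"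
      unfolding ldist_def by (rule member_le_sum) auto
    also have "\<dots> \<le> \<lceil>R\<rceil>" using * by linarith
    finally show "x $ i \<in> {x0 $ i - \<lceil>R\<rceil>..x0 $ i + \<lceil>R\<rceil>}" by auto
  qed
  moreover have "finite {x::int^'n. \<forall>i. x $ i \<in> {x0 $ i - \<lceil>R\<rceil>..x0 $ i + \<lceil>R\<rceil>}}"
    by (rule finite_subset[OF _ finite_imageI[OF finite_PiE, of UNIV "\<lambda>i. {x0 $ i - \<lceil>R\<rceil>..x0 $ i + \<lceil>R\<rceil>}" vec_lambda]])
      (auto simp: image_iff PiE_iff intro!: bexI[of _ "vec_nth _"])
  ultimately show ?thesis by (rule finite_subset)
qed

text \<open>The form in which (h_2) enters the rest of the proof; it plays the part of a compact
  embedding.\<close>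

lemma finite_sublevel:
  fixes h :: "int^'n \<Rightarrow> real"
  assumes "\<forall>M. \<exists>R. \<forall>x. real_of_int (ldist x x0) \<ge> R \<longrightarrow> h x \<ge> M"
  shows "finite {x. h x < M}"
proof -
  obtain R where "\<And>x. real_of_int (ldist x x0) \<ge> R \<Longrightarrow> h x \<ge> M"
    using assms by blast
  then have "{x. h x < M} \<subseteq> {x. real_of_int (ldist x x0) < R}"
    by (force simp: not_le[symmetric])
  then show ?thesis by (rule finite_subset[OF _ finite_ldist_ball])
qed

section \<open>The quadratic form\<close>

abbreviation square_summable :: "('x \<Rightarrow> real) \<Rightarrow> bool" where
  "square_summable u \<equiv> (\<lambda>x. (u x)\<^sup>2) summable_on UNIV"

lemma summable_on_abs_le:
  fixes f g :: "'x \<Rightarrow> real"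
  assumes "g summable_on A" "\<And>x. x \<in> A \<Longrightarrow> \<bar>f x\<bar> \<le> g x"
  shows "f summable_on A"
proof -
  have "(\<lambda>x. \<bar>f x\<bar>) summable_on A"
    by (rule summable_on_comparison_test[OF assms(1)]) (use assms(2) in auto)
  then show ?thesis using summable_on_iff_abs_summable_on_real[of f A] by simp
qed

text \<open>The order s and the decay of w survive only as uniformly bounded row sums, and (h_2) as
  finiteness of sublevel sets.\<close>

locale kirchhoff =
  fixes w :: "int^'n \<Rightarrow> int^'n \<Rightarrow> real" and h :: "int^'n \<Rightarrow> real" and a b p W h0 :: real
  assumes w_sym: "w x y = w y x"
    and w_nonneg: "x \<noteq> y \<Longrightarrow> 0 \<le> w x y"
    and w_summable: "w x summable_on (UNIV - {x})"
    and w_row: "infsum (w x) (UNIV - {x}) \<le> W"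
    and a_pos: "0 < a" and b_pos: "0 < b" and p_gt: "4 < p"
    and h0_pos: "0 < h0" and h_ge: "h0 \<le> h x"
    and h_sublevel: "finite {x. h x < M}"
begin

text \<open>Extends the weight by 0 to the diagonal, so that sums run over all pairs and can be
  reindexed by swapping coordinates.\<close>

definition ker :: "int^'n \<Rightarrow> int^'n \<Rightarrow> real" where
  "ker x y = (if x = y then 0 else w x y)"

definition Q :: "(int^'n \<Rightarrow> real) \<Rightarrow> (int^'n \<Rightarrow> real) \<Rightarrow> real" where
  "Q u v = (1/2) * (\<Sum>\<^sub>\<infinity>(x, y). ker x y * (u x - u y) * (v x - v y))"

lemma ker_nonneg: "0 \<le> ker x y"
  by (simp add: ker_def w_nonneg)

lemma ker_sym: "ker x y = ker y x"
  by (simp add: ker_def w_sym[of x y])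

lemma ker_summable: "ker x summable_on UNIV"
proof -
  have "ker x summable_on UNIV \<longleftrightarrow> w x summable_on (UNIV - {x})"
    by (rule summable_on_cong_neutral) (auto simp: ker_def)
  then show ?thesis using w_summable by simp
qed

lemma ker_row: "infsum (ker x) UNIV \<le> W"
proof -
  have "infsum (ker x) UNIV = infsum (w x) (UNIV - {x})"
    by (rule infsum_cong_neutral) (auto simp: ker_def)
  then show ?thesis using w_row by simp
qed

lemma W_nonneg: "W \<ge> 0"
proof -
  have "infsum (ker x) UNIV \<ge> 0" for x
    by (rule infsum_nonneg) (rule ker_nonneg)
  with ker_row show ?thesis using order_trans by blast
qed

text \<open>The Schur test: summing over y first gives at most W (u x)^2 in each row. The statements
  with u y follow by swapping coordinates, because the kernel is symmetric.\<close>

lemma ker_square_summable: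
  assumes "square_summable u"
  shows "(\<lambda>(x, y). ker x y * (u x)\<^sup>2) summable_on UNIV"
    and "(\<lambda>(x, y). ker x y * (u y)\<^sup>2) summable_on UNIV"
    and "(\<Sum>\<^sub>\<infinity>(x, y). ker x y * (u x)\<^sup>2) \<le> W * infsum (\<lambda>x. (u x)\<^sup>2) UNIV"
    and "(\<Sum>\<^sub>\<infinity>(x, y). ker x y * (u y)\<^sup>2) = (\<Sum>\<^sub>\<infinity>(x, y). ker x y * (u x)\<^sup>2)"
proof -
  have hs: "((\<lambda>y. (case (x, y) of (x, y) \<Rightarrow> ker x y * (u x)\<^sup>2)) has_sum infsum (ker x) UNIV * (u x)\<^sup>2) UNIV" for x
    using has_sum_cmult_left[OF has_sum_infsum[OF ker_summable[of x]], of "(u x)\<^sup>2"] by simp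
  have Wu: "(\<lambda>x. W * (u x)\<^sup>2) summable_on UNIV"
    by (intro summable_on_cmult_right assms)
  have le: "infsum (ker x) UNIV * (u x)\<^sup>2 \<le> W * (u x)\<^sup>2" for x
    by (intro mult_right_mono ker_row) auto
  have g: "(\<lambda>x. infsum (ker x) UNIV * (u x)\<^sup>2) summable_on UNIV"
    by (rule summable_on_comparison_test[OF Wu])
      (auto intro!: le mult_nonneg_nonneg infsum_nonneg ker_nonneg)
  have "(\<lambda>(x, y). ker x y * (u x)\<^sup>2) summable_on (SIGMA x:UNIV. UNIV)"
    by (rule summable_on_SigmaI[OF hs g]) (auto intro!: mult_nonneg_nonneg ker_nonneg)
  then show 1: "(\<lambda>(x, y). ker x y * (u x)\<^sup>2) summable_on UNIV" by simp
  have "(\<Sum>\<^sub>\<infinity>(x, y). ker x y * (u x)\<^sup>2) = (\<Sum>\<^sub>\<infinity>x. \<Sum>\<^sub>\<infinity>y. ker x y * (u x)\<^sup>2)"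
    using infsum_Sigma'_banach[of "\<lambda>x y. ker x y * (u x)\<^sup>2" UNIV "\<lambda>_. UNIV"] 1 by simp
  also have "\<dots> = (\<Sum>\<^sub>\<infinity>x. infsum (ker x) UNIV * (u x)\<^sup>2)"
    by (intro infsum_cong infsum_cmult_left')
  also have "\<dots> \<le> (\<Sum>\<^sub>\<infinity>x. W * (u x)\<^sup>2)"
    by (rule infsum_mono[OF g Wu le])
  finally show "(\<Sum>\<^sub>\<infinity>(x, y). ker x y * (u x)\<^sup>2) \<le> W * infsum (\<lambda>x. (u x)\<^sup>2) UNIV"
    by (simp add: infsum_cmult_right')
  have eq: "(\<lambda>(x, y). ker x y * (u y)\<^sup>2) = (\<lambda>z. (\<lambda>(x, y). ker x y * (u x)\<^sup>2) (prod.swap z))"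
    by (auto simp: fun_eq_iff ker_sym)
  have bij: "bij_betw prod.swap UNIV UNIV" by (simp add: bij_betw_def)
  show "(\<lambda>(x, y). ker x y * (u y)\<^sup>2) summable_on UNIV"
    unfolding eq by (subst summable_on_reindex_bij_betw[OF bij]) (rule 1)
  show "(\<Sum>\<^sub>\<infinity>(x, y). ker x y * (u y)\<^sup>2) = (\<Sum>\<^sub>\<infinity>(x, y). ker x y * (u x)\<^sup>2)"
    unfolding eq by (rule infsum_reindex_bij_betw[OF bij])
qed

lemma pair_summable:
  assumes "square_summable u" "square_summable v"
  shows "(\<lambda>(x, y). ker x y * (u x - u y) * (v x - v y)) summable_on UNIV"
proof (rule summable_on_abs_le)
  show "(\<lambda>z. ((\<lambda>(x, y). ker x y * (u x)\<^sup>2) z + (\<lambda>(x, y). ker x y * (u y)\<^sup>2) z)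
     + ((\<lambda>(x, y). ker x y * (v x)\<^sup>2) z + (\<lambda>(x, y). ker x y * (v y)\<^sup>2) z)) summable_on UNIV"
    by (intro summable_on_add ker_square_summable assms)
  fix z :: "(int^'n) \<times> (int^'n)"
  obtain x y where z: "z = (x, y)" by fastforce
  have "\<bar>(u x - u y) * (v x - v y)\<bar> \<le> (u x)\<^sup>2 + (u y)\<^sup>2 + ((v x)\<^sup>2 + (v y)\<^sup>2)"
  proof -
    have "2 * \<bar>(u x - u y) * (v x - v y)\<bar> \<le> (u x - u y)\<^sup>2 + (v x - v y)\<^sup>2"
      using sum_squares_bound[of "\<bar>u x - u y\<bar>" "\<bar>v x - v y\<bar>"] by (simp add: abs_mult)
    also have "\<dots> \<le> 2 * ((u x)\<^sup>2 + (u y)\<^sup>2) + 2 * ((v x)\<^sup>2 + (v y)\<^sup>2)"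
      using sum_squares_bound[of "u x" "- u y"] sum_squares_bound[of "v x" "- v y"]
      by (simp add: power2_diff)
    finally show ?thesis by simp
  qed
  from mult_left_mono[OF this ker_nonneg[of x y]]
  show "\<bar>case z of (x, y) \<Rightarrow> ker x y * (u x - u y) * (v x - v y)\<bar>
     \<le> ((\<lambda>(x, y). ker x y * (u x)\<^sup>2) z + (\<lambda>(x, y). ker x y * (u y)\<^sup>2) z)
     + ((\<lambda>(x, y). ker x y * (v x)\<^sup>2) z + (\<lambda>(x, y). ker x y * (v y)\<^sup>2) z)"
    by (simp add: z mult.assoc abs_mult[of "ker x y"] ker_nonneg distrib_left)
qed

lemma gradprod_eq: "gradprod w u v x = (1/2) * (\<Sum>\<^sub>\<infinity>y. ker x y * (u x - u y) * (v x - v y))"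
proof -
  have "(\<Sum>\<^sub>\<infinity>y\<in>UNIV - {x}. w x y * (u x - u y) * (v x - v y)) = (\<Sum>\<^sub>\<infinity>y. ker x y * (u x - u y) * (v x - v y))"
    by (rule infsum_cong_neutral) (auto simp: ker_def)
  then show ?thesis by (simp add: gradprod_def)
qed

text \<open>Fubini identifies the iterated sum of the definitions with the sum over pairs.\<close>

lemma gradprod_summable:
  assumes "square_summable u" "square_summable v"
  shows "gradprod w u v summable_on UNIV" "infsum (gradprod w u v) UNIV = Q u v"
proof -
  have *: "(\<lambda>(x, y). ker x y * (u x - u y) * (v x - v y)) summable_on (SIGMA x:UNIV. UNIV)"
    using pair_summable[OF assms] by simp
  have eq: "gradprod w u v = (\<lambda>x. (1/2) * (\<Sum>\<^sub>\<infinity>y. ker x y * (u x - u y) * (v x - v y)))"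
    by (simp add: fun_eq_iff gradprod_eq)
  show "gradprod w u v summable_on UNIV"
    unfolding eq by (intro summable_on_cmult_right summable_on_Sigma_banach[OF *])
  show "infsum (gradprod w u v) UNIV = Q u v"
    unfolding eq Q_def infsum_cmult_right' using infsum_Sigma'_banach[OF *] by simp
qed

lemma gradient_row_summable:
  assumes "square_summable u"
  shows "(\<lambda>y. w x y * (u x - u y)\<^sup>2) summable_on (UNIV - {x})"
proof -
  have *: "(\<lambda>(x, y). ker x y * (u x - u y) * (u x - u y)) summable_on (SIGMA x:UNIV. UNIV)"
    using pair_summable[OF assms assms] by simp
  have "(\<lambda>y. ker x y * (u x - u y) * (u x - u y)) summable_on UNIV"
    by (rule summable_on_SigmaD1[OF *]) auto
  then show ?thesis
    by (rule summable_on_cong_neutral[THEN iffD1, rotated 3]) (auto simp: ker_def power2_eq_square)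
qed

section \<open>Bilinearity, boundedness and integration by parts\<close>

lemma Q_sym: "Q u v = Q v u"
  unfolding Q_def by (simp only: mult.assoc mult.commute[of "u _ - u _"])

lemma Q_add_right:
  assumes "square_summable u" "square_summable v" "square_summable v'"
  shows "Q u (\<lambda>x. c * v x + d * v' x) = c * Q u v + d * Q u v'"
proof -
  have "Q u (\<lambda>x. c * v x + d * v' x) = (1/2) * (\<Sum>\<^sub>\<infinity>z. c * (\<lambda>(x, y). ker x y * (u x - u y) * (v x - v y)) z
     + d * (\<lambda>(x, y). ker x y * (u x - u y) * (v' x - v' y)) z)"
    unfolding Q_def by (intro arg_cong2[where f = times] refl infsum_cong) (auto simp: algebra_simps)
  also have "\<dots> = c * Q u v + d * Q u v'"
    by (subst infsum_add)
      (auto intro!: summable_on_cmult_right pair_summable assms simp: infsum_cmult_right' Q_def)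
  finally show ?thesis .
qed

lemma Q_add_left:
  assumes "square_summable u" "square_summable v" "square_summable v'"
  shows "Q (\<lambda>x. c * v x + d * v' x) u = c * Q v u + d * Q v' u"
  using Q_add_right[OF assms] by (metis Q_sym)

lemma Q_self_nonneg: "Q u u \<ge> 0"
proof -
  have "0 \<le> ker x y * (u x - u y) * (u x - u y)" for x y
    by (simp add: mult.assoc ker_nonneg)
  then show ?thesis
    unfolding Q_def by (auto intro!: infsum_nonneg)
qed

text \<open>From (u x - u y)^2 <= 2 (u x)^2 + 2 (u y)^2 and the Schur bound. It makes the gradient
  energy harmless on l^2.\<close>

lemma Q_self_le:
  assumes "square_summable u"
  shows "Q u u \<le> 2 * W * infsum (\<lambda>x. (u x)\<^sup>2) UNIV"
proof -
  have "(\<Sum>\<^sub>\<infinity>(x, y). ker x y * (u x - u y) * (u x - u y))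
     \<le> (\<Sum>\<^sub>\<infinity>z. 2 * (\<lambda>(x, y). ker x y * (u x)\<^sup>2) z + 2 * (\<lambda>(x, y). ker x y * (u y)\<^sup>2) z)"
  proof (rule infsum_mono)
    fix z :: "(int^'n) \<times> (int^'n)"
    obtain x y where z: "z = (x, y)" by fastforce
    have "(u x - u y) * (u x - u y) \<le> 2 * (u x)\<^sup>2 + 2 * (u y)\<^sup>2"
      using sum_squares_bound[of "u x" "- u y"] by (simp add: power2_eq_square algebra_simps)
    from mult_left_mono[OF this ker_nonneg[of x y]]
    show "(case z of (x, y) \<Rightarrow> ker x y * (u x - u y) * (u x - u y))
      \<le> 2 * (\<lambda>(x, y). ker x y * (u x)\<^sup>2) z + 2 * (\<lambda>(x, y). ker x y * (u y)\<^sup>2) z"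
      by (simp add: z algebra_simps)
  qed (intro pair_summable summable_on_add summable_on_cmult_right ker_square_summable assms)+
  also have "\<dots> = 4 * (\<Sum>\<^sub>\<infinity>(x, y). ker x y * (u x)\<^sup>2)"
    by (subst infsum_add) (auto intro!: summable_on_cmult_right ker_square_summable assms
        simp: infsum_cmult_right' ker_square_summable(4)[OF assms])
  also have "\<dots> \<le> 4 * (W * infsum (\<lambda>x. (u x)\<^sup>2) UNIV)"
    using ker_square_summable(3)[OF assms] by simp
  finally show ?thesis by (simp add: Q_def)
qed

text \<open>The operator (-Delta)^s of the equation.\<close>

definition lap :: "(int^'n \<Rightarrow> real) \<Rightarrow> int^'n \<Rightarrow> real" where
  "lap u x = (\<Sum>\<^sub>\<infinity>y. ker x y * (u x - u y))"

text \<open>The symmetric summand of \<open>Q\<close> is f(x,y) + f(y,x) with f(x,y) = v x * (ker x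
  y * (u x - u y)). Since f is summable over pairs, both halves have the same sum.\<close>

lemma Q_by_parts:
  assumes "square_summable u" "square_summable v"
  shows "(\<lambda>x. v x * lap u x) summable_on UNIV" "Q u v = (\<Sum>\<^sub>\<infinity>x. v x * lap u x)"
proof -
  define f where "f = (\<lambda>(x, y). v x * (ker x y * (u x - u y)))"
  have fs: "f summable_on UNIV"
  proof (rule summable_on_abs_le)
    show "(\<lambda>z. ((\<lambda>(x, y). ker x y * (u x)\<^sup>2) z + (\<lambda>(x, y). ker x y * (u y)\<^sup>2) z)
       + (\<lambda>(x, y). ker x y * (v x)\<^sup>2) z) summable_on UNIV"
      by (intro summable_on_add ker_square_summable assms)
    fix z :: "(int^'n) \<times> (int^'n)"
    obtain x y where z: "z = (x, y)" by fastforce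
    have "\<bar>v x * (u x - u y)\<bar> \<le> (u x)\<^sup>2 + (u y)\<^sup>2 + (v x)\<^sup>2"
    proof -
      have "2 * \<bar>v x * (u x - u y)\<bar> \<le> (v x)\<^sup>2 + (u x - u y)\<^sup>2"
        using sum_squares_bound[of "\<bar>v x\<bar>" "\<bar>u x - u y\<bar>"] by (simp add: abs_mult)
      also have "\<dots> \<le> 2 * (v x)\<^sup>2 + 2 * ((u x)\<^sup>2 + (u y)\<^sup>2)"
      proof -
        have "- (2 * u x * u y) \<le> (u x)\<^sup>2 + (u y)\<^sup>2"
          using sum_squares_bound[of "u x" "- u y"] by simp
        then show ?thesis
          unfolding power2_diff using zero_le_power2[of "v x"] by (smt (verit))
      qed
      finally show ?thesis by simp
    qed
    from mult_left_mono[OF this ker_nonneg[of x y]]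
    show "\<bar>f z\<bar> \<le> ((\<lambda>(x, y). ker x y * (u x)\<^sup>2) z + (\<lambda>(x, y). ker x y * (u y)\<^sup>2) z)
       + (\<lambda>(x, y). ker x y * (v x)\<^sup>2) z"
      by (simp only: z f_def prod.case mult.left_commute[of "v x"] abs_mult[of "ker x y"] abs_of_nonneg[OF ker_nonneg] distrib_left)
  qed
  then have fs': "(\<lambda>(x, y). v x * (ker x y * (u x - u y))) summable_on (SIGMA x:UNIV. UNIV)"
    by (simp add: f_def)
  have row: "(\<Sum>\<^sub>\<infinity>y. v x * (ker x y * (u x - u y))) = v x * lap u x" for x
    by (simp add: infsum_cmult_right' lap_def)
  show "(\<lambda>x. v x * lap u x) summable_on UNIV"
    using summable_on_Sigma_banach[OF fs'] by (simp add: row)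
  have fl: "infsum f UNIV = (\<Sum>\<^sub>\<infinity>x. v x * lap u x)"
    using infsum_Sigma'_banach[OF fs'] by (simp add: row f_def)
  have bij: "bij_betw prod.swap UNIV UNIV" by (simp add: bij_betw_def)
  have fs2: "(\<lambda>z. f (prod.swap z)) summable_on UNIV"
    by (subst summable_on_reindex_bij_betw[OF bij]) (rule fs)
  have "(\<Sum>\<^sub>\<infinity>(x, y). ker x y * (u x - u y) * (v x - v y)) = (\<Sum>\<^sub>\<infinity>z. f z + f (prod.swap z))"
    by (intro infsum_cong) (auto simp: f_def ker_sym algebra_simps)
  also have "\<dots> = infsum f UNIV + infsum f UNIV"
    by (subst infsum_add[OF fs fs2]) (simp add: infsum_reindex_bij_betw[OF bij])
  finally show "Q u v = (\<Sum>\<^sub>\<infinity>x. v x * lap u x)"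
    by (simp add: Q_def fl)
qed

end

section \<open>The energy functional\<close>

context kirchhoff
begin

lemma p_pos: "p > 0" and p_gt_2: "p > 2" and p_nonzero: "p \<noteq> 0"
  using p_gt by auto

lemma h_pos: "h x > 0"
  using h0_pos h_ge[of x] by linarith

text \<open>No gradient term is needed: h >= h0 gives square summability, and this controls the
  gradient. \<open>H_space_iff\<close> shows that nothing is lost.\<close>

definition finite_energy :: "(int^'n \<Rightarrow> real) \<Rightarrow> bool" where
  "finite_energy u \<longleftrightarrow> (\<lambda>x. h x * (u x)\<^sup>2) summable_on UNIV"

definition V :: "(int^'n \<Rightarrow> real) \<Rightarrow> (int^'n \<Rightarrow> real) \<Rightarrow> real" where
  "V u v = (\<Sum>\<^sub>\<infinity>x. h x * u x * v x)"

definition P :: "(int^'n \<Rightarrow> real) \<Rightarrow> real" where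
  "P u = (\<Sum>\<^sub>\<infinity>x. \<bar>u x\<bar> powr p)"

definition L :: "(int^'n \<Rightarrow> real) \<Rightarrow> real" where
  "L u = (\<Sum>\<^sub>\<infinity>x. logterm p (u x))"

lemma finite_energy_square_summable:
  assumes "finite_energy u"
  shows "square_summable u" "h0 * infsum (\<lambda>x. (u x)\<^sup>2) UNIV \<le> V u u"
proof -
  have *: "(\<lambda>x. h x * u x * u x) summable_on UNIV"
    using assms by (simp add: finite_energy_def power2_eq_square mult.assoc)
  have le: "h0 * (u x)\<^sup>2 \<le> h x * u x * u x" for x
    unfolding mult.assoc power2_eq_square using h_ge by (intro mult_right_mono) auto
  have "(\<lambda>x. h0 * (u x)\<^sup>2) summable_on UNIV"
    by (rule summable_on_comparison_test[OF *]) (use le h0_pos in auto)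
  then show ss: "square_summable u"
    using h0_pos summable_on_cmult_right'[of h0] by auto
  have "(\<Sum>\<^sub>\<infinity>x. h0 * (u x)\<^sup>2) \<le> V u u"
    unfolding V_def by (intro infsum_mono le * summable_on_cmult_right ss)
  then show "h0 * infsum (\<lambda>x. (u x)\<^sup>2) UNIV \<le> V u u"
    by (simp add: infsum_cmult_right')
qed

section \<open>Closure and summability properties of finite energy\<close>

lemma finite_energy_lincomb:
  assumes "finite_energy u" "finite_energy v"
  shows "finite_energy (\<lambda>x. c * u x + d * v x)"
  unfolding finite_energy_def
proof (rule summable_on_comparison_test)
  show "(\<lambda>x. 2 * c\<^sup>2 * (h x * (u x)\<^sup>2) + 2 * d\<^sup>2 * (h x * (v x)\<^sup>2)) summable_on UNIV"
    using assms by (intro summable_on_add summable_on_cmult_right) (auto simp: finite_energy_def)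
  fix x
  have "(c * u x + d * v x)\<^sup>2 \<le> 2 * c\<^sup>2 * (u x)\<^sup>2 + 2 * d\<^sup>2 * (v x)\<^sup>2"
    using sum_squares_bound[of "c * u x" "d * v x"] by (simp add: power2_sum power_mult_distrib)
  from mult_left_mono[OF this less_imp_le[OF h_pos]]
  show "h x * (c * u x + d * v x)\<^sup>2 \<le> 2 * c\<^sup>2 * (h x * (u x)\<^sup>2) + 2 * d\<^sup>2 * (h x * (v x)\<^sup>2)"
    by (simp add: algebra_simps)
  show "0 \<le> h x * (c * u x + d * v x)\<^sup>2"
    using h_pos[of x] by simp
qed

lemma finite_energy_dominated:
  assumes "finite_energy v" "\<And>x. \<bar>u x\<bar> \<le> \<bar>v x\<bar>"
  shows "finite_energy u"
  unfolding finite_energy_def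
proof (rule summable_on_comparison_test)
  show "(\<lambda>x. h x * (v x)\<^sup>2) summable_on UNIV"
    using assms by (simp add: finite_energy_def)
  show "h x * (u x)\<^sup>2 \<le> h x * (v x)\<^sup>2" for x
    using assms(2) h_pos[of x] by (simp add: abs_le_square_iff)
  show "0 \<le> h x * (u x)\<^sup>2" for x
    using h_pos[of x] by simp
qed

lemma finite_energy_pos_part: "finite_energy v \<Longrightarrow> finite_energy (pos_part v)"
  and finite_energy_neg_part: "finite_energy v \<Longrightarrow> finite_energy (neg_part v)"
  by (auto intro: finite_energy_dominated simp: pos_part_def neg_part_def)

lemma finite_energy_finite_support:
  assumes "finite {x. u x \<noteq> 0}"
  shows "finite_energy u"
  unfolding finite_energy_def
  by (rule finite_nonzero_values_imp_summable_on, rule finite_subset[OF _ assms]) auto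

lemma finite_energy_bounded:
  assumes "finite_energy u"
  obtains B where "\<And>x. \<bar>u x\<bar> \<le> B"
proof -
  have "(u x)\<^sup>2 \<le> infsum (\<lambda>x. (u x)\<^sup>2) UNIV" for x
    using finite_sum_le_infsum[OF finite_energy_square_summable(1)[OF assms], of "{x}"] by simp
  then have "\<bar>u x\<bar> \<le> sqrt (infsum (\<lambda>x. (u x)\<^sup>2) UNIV)" for x
    by (metis real_sqrt_abs real_sqrt_le_mono)
  then show ?thesis using that by blast
qed

lemma V_summable:
  assumes "finite_energy u" "finite_energy v"
  shows "(\<lambda>x. h x * u x * v x) summable_on UNIV"
proof (rule summable_on_abs_le)
  show "(\<lambda>x. h x * (u x)\<^sup>2 + h x * (v x)\<^sup>2) summable_on UNIV"
    using assms by (intro summable_on_add) (auto simp: finite_energy_def)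
  fix x
  have "2 * \<bar>u x * v x\<bar> \<le> (u x)\<^sup>2 + (v x)\<^sup>2"
    using sum_squares_bound[of "\<bar>u x\<bar>" "\<bar>v x\<bar>"] by (simp add: abs_mult)
  moreover have "0 \<le> \<bar>u x * v x\<bar>" by simp
  ultimately have "\<bar>u x * v x\<bar> \<le> (u x)\<^sup>2 + (v x)\<^sup>2" by linarith
  from mult_left_mono[OF this less_imp_le[OF h_pos]]
  show "\<bar>h x * u x * v x\<bar> \<le> h x * (u x)\<^sup>2 + h x * (v x)\<^sup>2"
    using h_pos[of x] by (simp add: abs_mult mult.assoc distrib_left)
qed

lemma V_self_nonneg: "V u u \<ge> 0"
  unfolding V_def mult.assoc using h_pos by (intro infsum_nonneg) (simp add: less_imp_le)

lemma V_lincomb: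
  assumes "finite_energy u" "finite_energy v" "finite_energy v'"
  shows "V u (\<lambda>x. c * v x + d * v' x) = c * V u v + d * V u v'"
proof -
  have "V u (\<lambda>x. c * v x + d * v' x) = (\<Sum>\<^sub>\<infinity>x. c * (h x * u x * v x) + d * (h x * u x * v' x))"
    unfolding V_def by (intro infsum_cong) (simp add: algebra_simps)
  also have "\<dots> = c * V u v + d * V u v'"
    by (subst infsum_add) (auto intro!: summable_on_cmult_right V_summable assms
        simp: infsum_cmult_right' V_def)
  finally show ?thesis .
qed

text \<open>A function of finite energy is bounded, so the nonlinear terms are dominated by
  squares.\<close>

lemma nonlinear_summable:
  assumes "finite_energy u"
  shows "(\<lambda>x. \<bar>u x\<bar> powr p) summable_on UNIV" "(\<lambda>x. logterm p (u x)) summable_on UNIV"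
    and "finite_energy \<phi> \<Longrightarrow> (\<lambda>x. fnl p (u x) * \<phi> x) summable_on UNIV"
proof -
  obtain B where B: "\<And>x. \<bar>u x\<bar> \<le> B" using finite_energy_bounded[OF assms] by blast
  obtain C where C: "C > 0" "\<And>t. \<bar>t\<bar> \<le> B \<Longrightarrow> \<bar>logterm p t\<bar> \<le> C * t\<^sup>2"
    "\<And>t. \<bar>t\<bar> \<le> B \<Longrightarrow> \<bar>fnl p t\<bar> \<le> C * \<bar>t\<bar>" "\<And>t. \<bar>t\<bar> \<le> B \<Longrightarrow> \<bar>t\<bar> powr p \<le> C * t\<^sup>2"
    using nonlinearity_bounds[OF p_gt_2] by blast
  have s: "(\<lambda>x. C * (u x)\<^sup>2) summable_on UNIV"
    by (intro summable_on_cmult_right finite_energy_square_summable assms)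
  show "(\<lambda>x. \<bar>u x\<bar> powr p) summable_on UNIV"
    by (rule summable_on_abs_le[OF s]) (use C(4) B in auto)
  show "(\<lambda>x. logterm p (u x)) summable_on UNIV"
    by (rule summable_on_abs_le[OF s]) (use C(2) B in auto)
  assume \<phi>: "finite_energy \<phi>"
  have s2: "(\<lambda>x. C * (u x)\<^sup>2 + C * (\<phi> x)\<^sup>2) summable_on UNIV"
    by (intro summable_on_add summable_on_cmult_right finite_energy_square_summable assms \<phi>)
  show "(\<lambda>x. fnl p (u x) * \<phi> x) summable_on UNIV"
  proof (rule summable_on_abs_le[OF s2])
    fix x
    have "2 * (\<bar>u x\<bar> * \<bar>\<phi> x\<bar>) \<le> (u x)\<^sup>2 + (\<phi> x)\<^sup>2"
      using sum_squares_bound[of "\<bar>u x\<bar>" "\<bar>\<phi> x\<bar>"] by simp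
    moreover have "0 \<le> \<bar>u x\<bar> * \<bar>\<phi> x\<bar>" by simp
    ultimately have *: "\<bar>u x\<bar> * \<bar>\<phi> x\<bar> \<le> (u x)\<^sup>2 + (\<phi> x)\<^sup>2" by linarith
    have "\<bar>fnl p (u x) * \<phi> x\<bar> \<le> C * \<bar>u x\<bar> * \<bar>\<phi> x\<bar>"
      unfolding abs_mult using C(3)[OF B] by (intro mult_right_mono) auto
    also have "\<dots> \<le> C * ((u x)\<^sup>2 + (\<phi> x)\<^sup>2)"
      unfolding mult.assoc using C(1) * by (intro mult_left_mono) auto
    finally show "\<bar>fnl p (u x) * \<phi> x\<bar> \<le> C * (u x)\<^sup>2 + C * (\<phi> x)\<^sup>2"
      by (simp add: distrib_left)
  qed
qed

lemma gradnorm2_eq: "finite_energy u \<Longrightarrow> gradnorm2 w u = Q u u"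
  using gradprod_summable(2)[of u u] finite_energy_square_summable[of u]
  by (simp add: gradnorm2_def gradsq_def[abs_def])

section \<open>The energy, its derivative and the function space\<close>

lemma Jfun_eq:
  assumes "finite_energy u"
  shows "Jfun w a b p h u = a / 2 * Q u u + V u u / 2 + b / 4 * (Q u u)\<^sup>2 + 2 / p\<^sup>2 * P u - 1 / p * L u"
proof -
  note ss = finite_energy_square_summable(1)[OF assms]
  have "Hnorm2 w a h u = (\<Sum>\<^sub>\<infinity>x. a * gradprod w u u x + h x * u x * u x)"
    by (simp add: Hnorm2_def gradsq_def power2_eq_square mult.assoc)
  also have "\<dots> = a * Q u u + V u u"
    by (subst infsum_add) (auto intro!: summable_on_cmult_right V_summable assms gradprod_summable ss
        simp: infsum_cmult_right' V_def gradprod_summable(2)[OF ss ss])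
  finally show ?thesis
    by (simp add: Jfun_def gradnorm2_eq[OF assms] P_def L_def)
qed

lemma dJ_eq:
  assumes "finite_energy u" "finite_energy \<phi>"
  shows "dJ w a b p h u \<phi> = (a + b * Q u u) * Q u \<phi> + V u \<phi> - (\<Sum>\<^sub>\<infinity>x. fnl p (u x) * \<phi> x)"
proof -
  note ss = finite_energy_square_summable(1)[OF assms(1)] finite_energy_square_summable(1)[OF assms(2)]
  have "(\<Sum>\<^sub>\<infinity>x. a * gradprod w u \<phi> x + h x * u x * \<phi> x) = a * Q u \<phi> + V u \<phi>"
    by (subst infsum_add) (auto intro!: summable_on_cmult_right V_summable assms gradprod_summable ss
        simp: infsum_cmult_right' V_def gradprod_summable(2)[OF ss])
  then show ?thesis
    by (simp add: dJ_def gradnorm2_eq[OF assms(1)] gradprod_summable(2)[OF ss] algebra_simps)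
qed

lemma Wnorm2_le:
  assumes "square_summable u"
  shows "Wnorm2 w u \<le> (2 * W + 1) * infsum (\<lambda>x. (u x)\<^sup>2) UNIV" "0 \<le> Wnorm2 w u"
    "(\<lambda>x. gradsq w u x + (u x)\<^sup>2) summable_on UNIV"
proof -
  note g = gradprod_summable[OF assms assms]
  have "Wnorm2 w u = Q u u + infsum (\<lambda>x. (u x)\<^sup>2) UNIV"
    unfolding Wnorm2_def gradsq_def by (subst infsum_add) (auto simp: g intro!: assms)
  then show "Wnorm2 w u \<le> (2 * W + 1) * infsum (\<lambda>x. (u x)\<^sup>2) UNIV" "0 \<le> Wnorm2 w u"
    using Q_self_le[OF assms] Q_self_nonneg[of u] by (auto simp: algebra_simps intro!: add_nonneg_nonneg infsum_nonneg)
  show "(\<lambda>x. gradsq w u x + (u x)\<^sup>2) summable_on UNIV"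
    unfolding gradsq_def by (intro summable_on_add g assms)
qed

text \<open>Truncations to finite sets \<open>F k\<close> that carry all but 1/(k+1) of the l^2 mass
  converge to u in the W-norm, because that norm squared is at most (2 W + 1) times the l^2 norm
  squared.\<close>

lemma H_space_iff: "u \<in> H_space w h \<longleftrightarrow> finite_energy u"
proof
  show "finite_energy u" if "u \<in> H_space w h"
    using that by (simp add: H_space_def finite_energy_def)
next
  assume u: "finite_energy u"
  note ss = finite_energy_square_summable(1)[OF u]
  define S where "S = infsum (\<lambda>x. (u x)\<^sup>2) UNIV"
  have "\<exists>F. finite F \<and> dist (sum (\<lambda>x. (u x)\<^sup>2) F) S \<le> 1 / real (Suc k)" for k
    using infsum_finite_approximation[OF ss, of "1 / real (Suc k)"] unfolding S_def by auto
  then obtain F where F: "\<And>k. finite (F k)" "\<And>k. dist (sum (\<lambda>x. (u x)\<^sup>2) (F k)) S \<le> 1 / real (Suc k)"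
    by metis
  define \<phi> where "\<phi> k x = (if x \<in> F k then u x else 0)" for k x
  have fin: "finite {x. \<phi> k x \<noteq> 0}" for k
    by (rule finite_subset[OF _ F(1)[of k]]) (auto simp: \<phi>_def)
  have bound: "0 \<le> Wnorm2 w (\<lambda>x. \<phi> k x - u x) \<and> Wnorm2 w (\<lambda>x. \<phi> k x - u x) \<le> (2 * W + 1) * (1 / real (Suc k))" for k
  proof -
    have sd: "square_summable (\<lambda>x. \<phi> k x - u x)"
      by (rule summable_on_comparison_test[OF ss]) (auto simp: \<phi>_def)
    have "infsum (\<lambda>x. (\<phi> k x - u x)\<^sup>2) UNIV = infsum (\<lambda>x. (u x)\<^sup>2) (UNIV - F k)"
      by (rule infsum_cong_neutral) (auto simp: \<phi>_def)
    also have "\<dots> = S - sum (\<lambda>x. (u x)\<^sup>2) (F k)"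
      using infsum_Diff[OF ss summable_on_finite[OF F(1)]] F(1) by (simp add: S_def)
    also have "\<dots> \<le> 1 / real (Suc k)"
      using F(2)[of k] by (simp add: dist_real_def)
    finally have "(2 * W + 1) * infsum (\<lambda>x. (\<phi> k x - u x)\<^sup>2) UNIV \<le> (2 * W + 1) * (1 / real (Suc k))"
      using W_nonneg by (intro mult_left_mono) auto
    then show ?thesis
      using Wnorm2_le[OF sd] by linarith
  qed
  have "(\<lambda>k. (2 * W + 1) * (1 / real (Suc k))) \<longlonglongrightarrow> 0"
    by real_asymp
  then have "(\<lambda>k. Wnorm2 w (\<lambda>x. \<phi> k x - u x)) \<longlonglongrightarrow> 0"
    by (rule tendsto_sandwich[OF _ _ tendsto_const, rotated 2]) (use bound in auto)
  with fin have "\<exists>\<phi>. (\<forall>k::nat. finite {x. \<phi> k x \<noteq> 0}) \<and> (\<lambda>k. Wnorm2 w (\<lambda>x. \<phi> k x - u x)) \<longlonglongrightarrow> 0"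
    by blast
  then show "u \<in> H_space w h"
    using gradient_row_summable[OF ss] Wnorm2_le(3)[OF ss] u
    by (simp add: H_space_def W_space_def finite_energy_def)
qed

lemma V_P_pos:
  assumes "finite_energy u" "u \<noteq> (\<lambda>_. 0)"
  shows "V u u > 0" "P u > 0"
proof -
  obtain x where x: "u x \<noteq> 0" using assms by (auto simp: fun_eq_iff)
  have "0 < h x * (u x)\<^sup>2"
    using h_pos[of x] x by simp
  also have "\<dots> = h x * u x * u x"
    by (simp add: power2_eq_square)
  also have "\<dots> \<le> V u u"
    unfolding V_def using finite_sum_le_infsum[OF V_summable[OF assms(1,1)], of "{x}"] h_pos
    by (auto simp: mult.assoc less_imp_le)
  finally show "V u u > 0" .
  have "0 < \<bar>u x\<bar> powr p" using x by simp
  also have "\<dots> \<le> P u"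
    unfolding P_def using finite_sum_le_infsum[OF nonlinear_summable(1)[OF assms(1)], of "{x}"] by auto
  finally show "P u > 0" .
qed

text \<open>The logarithm turns scaling by c into an additive term. Hence every fibre formula has
  the two summands with \<open>L\<close> and \<open>P\<close>.\<close>

lemma logterm_sum:
  assumes "finite_energy u" "c \<ge> 0"
  shows "(\<Sum>\<^sub>\<infinity>x. logterm p (c * u x)) = c powr p * L u + P u * logterm p c"
    "(\<lambda>x. logterm p (c * u x)) summable_on UNIV"
proof -
  have eq: "(\<lambda>x. logterm p (c * u x)) = (\<lambda>x. c powr p * logterm p (u x) + \<bar>u x\<bar> powr p * logterm p c)"
    using assms(2) by (simp add: logterm_mult)
  have s: "(\<lambda>x. c powr p * logterm p (u x)) summable_on UNIV" "(\<lambda>x. \<bar>u x\<bar> powr p * logterm p c) summable_on UNIV"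
    using nonlinear_summable[OF assms(1)] by (auto intro: summable_on_cmult_right summable_on_cmult_left)
  show "(\<lambda>x. logterm p (c * u x)) summable_on UNIV"
    unfolding eq by (intro summable_on_add s)
  show "(\<Sum>\<^sub>\<infinity>x. logterm p (c * u x)) = c powr p * L u + P u * logterm p c"
    unfolding eq by (subst infsum_add[OF s]) (simp add: infsum_cmult_right' infsum_cmult_left' L_def P_def)
qed

end

section \<open>Fibres of sign-changing functions\<close>

context kirchhoff
begin

definition comb :: "(int^'n \<Rightarrow> real) \<Rightarrow> real \<Rightarrow> real \<Rightarrow> int^'n \<Rightarrow> real" where
  "comb v s t = (\<lambda>x. s * pos_part v x + t * neg_part v x)"

definition sign_changing :: "(int^'n \<Rightarrow> real) \<Rightarrow> bool" where
  "sign_changing v \<longleftrightarrow> finite_energy v \<and> pos_part v \<noteq> (\<lambda>_. 0) \<and> neg_part v \<noteq> (\<lambda>_. 0)"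

lemma sign_changing_iff: "sign_changing v \<longleftrightarrow> finite_energy v \<and> (\<exists>x. v x > 0) \<and> (\<exists>x. v x < 0)"
proof -
  have "max (v x) 0 \<noteq> 0 \<longleftrightarrow> v x > 0" "min (v x) 0 \<noteq> 0 \<longleftrightarrow> v x < 0" for x
    by auto
  then show ?thesis
    by (simp add: sign_changing_def pos_part_def neg_part_def fun_eq_iff)
qed

lemma M_set_iff: "v \<in> M_set w a b p h \<longleftrightarrow>
    sign_changing v \<and> dJ w a b p h v (pos_part v) = 0 \<and> dJ w a b p h v (neg_part v) = 0"
  by (auto simp: M_set_def H_space_iff sign_changing_def)

lemma comb_1_1 [simp]: "comb v 1 1 = v"
  by (auto simp: comb_def pos_part_def neg_part_def max_def min_def)

lemma pos_part_comb: "s \<ge> 0 \<Longrightarrow> t \<ge> 0 \<Longrightarrow> pos_part (comb v s t) = (\<lambda>x. s * pos_part v x)"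
  by (auto simp: comb_def pos_part_def neg_part_def max_def min_def fun_eq_iff
      zero_le_mult_iff mult_le_0_iff)

lemma neg_part_comb: "s \<ge> 0 \<Longrightarrow> t \<ge> 0 \<Longrightarrow> neg_part (comb v s t) = (\<lambda>x. t * neg_part v x)"
  by (auto simp: comb_def pos_part_def neg_part_def max_def min_def fun_eq_iff
      zero_le_mult_iff mult_le_0_iff)

lemma finite_energy_comb: "finite_energy v \<Longrightarrow> finite_energy (comb v s t)"
  unfolding comb_def by (intro finite_energy_lincomb finite_energy_pos_part finite_energy_neg_part)

lemma sign_changing_comb:
  assumes "sign_changing v" "s > 0" "t > 0"
  shows "sign_changing (comb v s t)"
  using assms finite_energy_comb[of v s t]
  by (auto simp: sign_changing_def pos_part_comb neg_part_comb fun_eq_iff)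

text \<open>Both parts are nondecreasing functions of the value of v, so their increments between x
  and y never have opposite signs.\<close>

lemma Q_pos_neg_nonneg: "Q (pos_part v) (neg_part v) \<ge> 0"
proof -
  have "ker x y * (pos_part v x - pos_part v y) * (neg_part v x - neg_part v y) \<ge> 0" for x y
    unfolding mult.assoc
    by (rule mult_nonneg_nonneg[OF ker_nonneg])
      (auto simp: pos_part_def neg_part_def max_def min_def zero_le_mult_iff)
  then show ?thesis
    unfolding Q_def by (auto intro!: infsum_nonneg)
qed

end

locale sign_changing_fibre = kirchhoff w h a b p W h0
  for w :: "int^'n \<Rightarrow> int^'n \<Rightarrow> real" and h a b p W h0 +
  fixes v :: "int^'n \<Rightarrow> real"
  assumes v: "sign_changing v"
begin

lemma fe: "finite_energy v" "finite_energy (pos_part v)" "finite_energy (neg_part v)"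
  using v finite_energy_pos_part finite_energy_neg_part by (auto simp: sign_changing_def)

sublocale F: fibre a b p "Q (pos_part v) (pos_part v)" "Q (pos_part v) (neg_part v)" "Q (neg_part v) (neg_part v)"
  "V (pos_part v) (pos_part v)" "V (neg_part v) (neg_part v)" "P (pos_part v)" "P (neg_part v)"
  "L (pos_part v)" "L (neg_part v)"
  by unfold_locales
    (use v in \<open>auto simp: a_pos b_pos p_gt Q_self_nonneg Q_pos_neg_nonneg sign_changing_def
      intro!: V_P_pos fe\<close>)

lemma Q_comb: "Q (comb v s t) (comb v s t) = F.G s t"
  and Q_comb_pos: "Q (comb v s t) (pos_part v) = s * Q (pos_part v) (pos_part v) + t * Q (pos_part v) (neg_part v)"
  and Q_comb_neg: "Q (comb v s t) (neg_part v) = s * Q (pos_part v) (neg_part v) + t * Q (neg_part v) (neg_part v)"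
proof -
  note ss = fe[THEN finite_energy_square_summable(1)] 
  have ssc: "square_summable (comb v s t)"
    using finite_energy_comb[OF fe(1)] by (rule finite_energy_square_summable)
  show 1: "Q (comb v s t) (pos_part v) = s * Q (pos_part v) (pos_part v) + t * Q (pos_part v) (neg_part v)"
    unfolding comb_def Q_add_left[OF ss(2) ss(2) ss(3)] by (simp add: Q_sym[of "neg_part v" "pos_part v"])
  show 2: "Q (comb v s t) (neg_part v) = s * Q (pos_part v) (neg_part v) + t * Q (neg_part v) (neg_part v)"
    unfolding comb_def Q_add_left[OF ss(3) ss(2) ss(3)] ..
  have "Q (comb v s t) (comb v s t) = s * Q (comb v s t) (pos_part v) + t * Q (comb v s t) (neg_part v)"
    using Q_add_right[OF ssc ss(2) ss(3), of s t] unfolding comb_def by simp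
  then show "Q (comb v s t) (comb v s t) = F.G s t"
    by (simp add: 1 2 F.G_def power2_eq_square algebra_simps)
qed

text \<open>v^+ and v^- have disjoint supports, so local sums split without a mixed term; only the
  nonlocal form \<open>Q\<close> produces one.\<close>

lemma V_comb: "V (comb v s t) (pos_part v) = s * V (pos_part v) (pos_part v)"
  "V (comb v s t) (neg_part v) = t * V (neg_part v) (neg_part v)"
  "V (comb v s t) (comb v s t) = s\<^sup>2 * V (pos_part v) (pos_part v) + t\<^sup>2 * V (neg_part v) (neg_part v)"
proof -
  have pn: "pos_part v x * neg_part v x = 0" for x
    by (auto simp: pos_part_def neg_part_def max_def min_def)
  show 1: "V (comb v s t) (pos_part v) = s * V (pos_part v) (pos_part v)"
    unfolding V_def infsum_cmult_right'[symmetric]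
    by (intro infsum_cong) (use pn in \<open>auto simp: comb_def algebra_simps\<close>)
  show 2: "V (comb v s t) (neg_part v) = t * V (neg_part v) (neg_part v)"
    unfolding V_def infsum_cmult_right'[symmetric]
    by (intro infsum_cong) (use pn in \<open>auto simp: comb_def algebra_simps\<close>)
  have "V (comb v s t) (comb v s t) = s * V (comb v s t) (pos_part v) + t * V (comb v s t) (neg_part v)"
    using V_lincomb[OF finite_energy_comb[OF fe(1)] fe(2,3), of s t s t] unfolding comb_def .
  then show "V (comb v s t) (comb v s t) = s\<^sup>2 * V (pos_part v) (pos_part v) + t\<^sup>2 * V (neg_part v) (neg_part v)"
    by (simp add: 1 2 power2_eq_square)
qed

lemma P_comb:
  assumes "s \<ge> 0" "t \<ge> 0"
  shows "P (comb v s t) = s powr p * P (pos_part v) + t powr p * P (neg_part v)"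
proof -
  have "P (comb v s t) = (\<Sum>\<^sub>\<infinity>x. s powr p * \<bar>pos_part v x\<bar> powr p + t powr p * \<bar>neg_part v x\<bar> powr p)"
    unfolding P_def
  proof (rule infsum_cong)
    show "\<bar>comb v s t x\<bar> powr p = s powr p * \<bar>pos_part v x\<bar> powr p + t powr p * \<bar>neg_part v x\<bar> powr p" for x
    proof (cases "v x > 0")
      case True
      then have "neg_part v x = 0" by (simp add: neg_part_def)
      then show ?thesis using assms by (simp add: comb_def abs_mult powr_mult)
    next
      case False
      then have "pos_part v x = 0" by (simp add: pos_part_def)
      then show ?thesis using assms by (simp add: comb_def abs_mult powr_mult)
    qed
  qed
  also have "\<dots> = s powr p * P (pos_part v) + t powr p * P (neg_part v)"
    by (subst infsum_add) (auto intro!: summable_on_cmult_right nonlinear_summable fe simp: infsum_cmult_right' P_def)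
  finally show ?thesis .
qed

lemma L_comb:
  assumes "s \<ge> 0" "t \<ge> 0"
  shows "L (comb v s t) = (s powr p * L (pos_part v) + P (pos_part v) * logterm p s)
     + (t powr p * L (neg_part v) + P (neg_part v) * logterm p t)"
proof -
  have "L (comb v s t) = (\<Sum>\<^sub>\<infinity>x. logterm p (s * pos_part v x) + logterm p (t * neg_part v x))"
    unfolding L_def
    by (intro infsum_cong) (auto simp: comb_def pos_part_def neg_part_def max_def min_def logterm_def[of p 0])
  also have "\<dots> = (\<Sum>\<^sub>\<infinity>x. logterm p (s * pos_part v x)) + (\<Sum>\<^sub>\<infinity>x. logterm p (t * neg_part v x))"
    using assms by (intro infsum_add logterm_sum fe)
  finally show ?thesis
    using assms by (simp add: logterm_sum fe)
qed

lemma Jfun_comb: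
  assumes "s \<ge> 0" "t \<ge> 0"
  shows "Jfun w a b p h (comb v s t) = F.N s t"
  unfolding Jfun_eq[OF finite_energy_comb[OF fe(1)]] Q_comb V_comb P_comb[OF assms] L_comb[OF assms]
  by (simp add: F.N_def F.psi_def distrib_left diff_divide_distrib add_divide_distrib mult_ac)

lemma dJ_comb:
  assumes "s \<ge> 0" "t \<ge> 0"
  shows "dJ w a b p h (comb v s t) (pos_part (comb v s t)) = F.R1 s t"
    and "dJ w a b p h (comb v s t) (neg_part (comb v s t)) = F.R2 s t"
proof -
  note fec = finite_energy_comb[OF fe(1), of s t]
  note ssc = finite_energy_square_summable(1)[OF fec]
  note ss = fe[THEN finite_energy_square_summable(1)] 
  have "fnl p (comb v s t x) * pos_part (comb v s t) x = logterm p (s * pos_part v x)" for x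
  proof (cases "v x > 0")
    case True
    then show ?thesis
      unfolding pos_part_comb[OF assms] by (simp add: comb_def pos_part_def neg_part_def fnl_times_self)
  next
    case False
    then show ?thesis
      unfolding pos_part_comb[OF assms] by (simp add: pos_part_def logterm_def max_def)
  qed
  \<comment> \<open>The summand with coefficient 0 brings the scaled part into the two-term shape of
    \<open>Q_add_right\<close> and \<open>V_lincomb\<close>.\<close>
  then have "dJ w a b p h (comb v s t) (pos_part (comb v s t)) = (a + b * F.G s t) * Q (comb v s t) (\<lambda>x. s * pos_part v x + 0 * pos_part v x)
     + V (comb v s t) (\<lambda>x. s * pos_part v x + 0 * pos_part v x) - (s powr p * L (pos_part v) + P (pos_part v) * logterm p s)"
    using dJ_eq[OF fec finite_energy_pos_part[OF fec]] assms by (simp add: Q_comb logterm_sum fe pos_part_comb)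
  then show "dJ w a b p h (comb v s t) (pos_part (comb v s t)) = F.R1 s t"
    unfolding Q_add_right[OF ssc ss(2) ss(2)] V_lincomb[OF fec fe(2) fe(2)]
    by (simp add: Q_comb_pos V_comb F.R1_def power2_eq_square algebra_simps)
  have "fnl p (comb v s t x) * neg_part (comb v s t) x = logterm p (t * neg_part v x)" for x
  proof (cases "v x < 0")
    case True
    then show ?thesis
      unfolding neg_part_comb[OF assms] by (simp add: comb_def pos_part_def neg_part_def fnl_times_self)
  next
    case False
    then show ?thesis
      unfolding neg_part_comb[OF assms] by (simp add: neg_part_def logterm_def min_def)
  qed
  then have "dJ w a b p h (comb v s t) (neg_part (comb v s t)) = (a + b * F.G s t) * Q (comb v s t) (\<lambda>x. t * neg_part v x + 0 * neg_part v x)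
     + V (comb v s t) (\<lambda>x. t * neg_part v x + 0 * neg_part v x) - (t powr p * L (neg_part v) + P (neg_part v) * logterm p t)"
    using dJ_eq[OF fec finite_energy_neg_part[OF fec]] assms by (simp add: Q_comb logterm_sum fe neg_part_comb)
  then show "dJ w a b p h (comb v s t) (neg_part (comb v s t)) = F.R2 s t"
    unfolding Q_add_right[OF ssc ss(3) ss(3)] V_lincomb[OF fec fe(3) fe(3)]
    by (simp add: Q_comb_neg V_comb F.R2_def power2_eq_square algebra_simps)
qed

lemma comb_in_M_set_iff:
  assumes "s > 0" "t > 0"
  shows "comb v s t \<in> M_set w a b p h \<longleftrightarrow> F.R1 s t = 0 \<and> F.R2 s t = 0"
  using sign_changing_comb[OF v assms] dJ_comb[of s t] assms by (simp add: M_set_iff)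

lemma in_M_set_iff: "v \<in> M_set w a b p h \<longleftrightarrow> F.R1 1 1 = 0 \<and> F.R2 1 1 = 0"
  using comb_in_M_set_iff[of 1 1] by simp

end

context kirchhoff
begin

section \<open>Consequences for the sign-changing Nehari set\<close>

lemma sign_changing_fibreI: "sign_changing v \<Longrightarrow> sign_changing_fibre w h a b p W h0 v"
  by unfold_locales

lemma M_set_sign_changing: "v \<in> M_set w a b p h \<Longrightarrow> sign_changing v"
  by (simp add: M_set_iff)

lemma Jfun_comb_le:
  assumes "v \<in> M_set w a b p h" "s \<ge> 0" "t \<ge> 0"
  shows "Jfun w a b p h (comb v s t) \<le> Jfun w a b p h v"
    and "(s, t) \<noteq> (1, 1) \<Longrightarrow> Jfun w a b p h (comb v s t) < Jfun w a b p h v"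
proof -
  interpret sign_changing_fibre w h a b p W h0 v
    by (intro sign_changing_fibreI M_set_sign_changing assms)
  show "Jfun w a b p h (comb v s t) \<le> Jfun w a b p h v"
    and "(s, t) \<noteq> (1, 1) \<Longrightarrow> Jfun w a b p h (comb v s t) < Jfun w a b p h v"
    using F.N_le_on_M[of s t] assms Jfun_comb[of s t] Jfun_comb[of 1 1] by (auto simp: in_M_set_iff)
qed

lemma comb_local_max_in_M_set:
  assumes v: "sign_changing v" and st: "s > 0" "t > 0" and d: "d > 0"
    and max: "\<And>s' t'. \<bar>s - s'\<bar> < d \<Longrightarrow> \<bar>t - t'\<bar> < d \<Longrightarrow>
        Jfun w a b p h (comb v s' t') \<le> Jfun w a b p h (comb v s t)"
  shows "comb v s t \<in> M_set w a b p h"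
proof -
  interpret sign_changing_fibre w h a b p W h0 v
    by (intro sign_changing_fibreI v)
  \<comment> \<open>The energy agrees with \<open>N\<close> only for nonnegative parameters; the
    minimum with s and t keeps the neighbourhood inside the quadrant.\<close>
  define e where "e = min d (min s t)"
  have "e > 0" using st d by (simp add: e_def)
  moreover have "F.N s' t' \<le> F.N s t" if "\<bar>s - s'\<bar> < e" "\<bar>t - t'\<bar> < e" for s' t'
  proof -
    have "s' \<ge> 0" "t' \<ge> 0" "\<bar>s - s'\<bar> < d" "\<bar>t - t'\<bar> < d"
      using that by (auto simp: e_def)
    with max[of s' t'] st show ?thesis by (simp add: Jfun_comb)
  qed
  ultimately show ?thesis
    using F.N_local_max_imp[of s t e] st by (simp add: comb_in_M_set_iff)
qed

lemma projection_to_M_set: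
  assumes v: "sign_changing v"
  obtains s t where "s > 0" "t > 0" "comb v s t \<in> M_set w a b p h"
proof -
  interpret sign_changing_fibre w h a b p W h0 v
    by (intro sign_changing_fibreI v)
  obtain s t where st: "s > 0" "t > 0" and max: "\<And>s' t'. s' \<ge> 0 \<Longrightarrow> t' \<ge> 0 \<Longrightarrow> F.N s' t' \<le> F.N s t"
    using F.N_attains_max by blast
  have "F.N s' t' \<le> F.N s t" if "\<bar>s - s'\<bar> < min s t" "\<bar>t - t'\<bar> < min s t" for s' t'
    using max that by auto
  then show ?thesis
    using that F.N_local_max_imp[of s t "min s t"] st by (simp add: comb_in_M_set_iff)
qed

lemma continuous_Jfun_comb:
  assumes v: "sign_changing v"
  shows "continuous_on ({0..} \<times> {0..}) (\<lambda>z. Jfun w a b p h (comb v (fst z) (snd z)))"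
proof -
  interpret sign_changing_fibre w h a b p W h0 v
    by (intro sign_changing_fibreI v)
  show ?thesis
    by (rule continuous_on_eq[OF F.continuous_N]) (auto simp: Jfun_comb)
qed

lemma L_pos_imp:
  assumes "L u > 0"
  obtains x where "\<bar>u x\<bar> > 1"
proof -
  have "\<exists>x. logterm p (u x) > 0"
  proof (rule ccontr)
    assume "\<not> ?thesis"
    then have "(\<Sum>\<^sub>\<infinity>x. - logterm p (u x)) \<ge> 0"
      by (intro infsum_nonneg) (simp add: not_less)
    with assms show False by (simp add: infsum_uminus L_def)
  qed
  then show ?thesis using that logterm_pos_imp by blast
qed

text \<open>On the lattice the nonlinearity is attractive only where \<open>\<bar>u\<bar> > 1\<close>; this keeps both parts
  of a minimising sequence away from zero.\<close>

lemma M_set_large_values: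
  assumes "v \<in> M_set w a b p h"
  shows "\<exists>x. v x > 1" "\<exists>x. v x < - 1"
proof -
  interpret sign_changing_fibre w h a b p W h0 v
    by (intro sign_changing_fibreI M_set_sign_changing assms)
  have R: "F.R1 1 1 = 0" "F.R2 1 1 = 0" using assms by (auto simp: in_M_set_iff)
  have c: "a + b * F.G 1 1 \<ge> 0"
    using F.G1 F.G2 F.K a_pos b_pos by (auto simp: F.G_def)
  \<comment> \<open>The vanishing residual equates this sum with a nonnegative gradient term plus a
    positive potential energy.\<close>
  have "L (pos_part v) > 0"
    using R(1) mult_nonneg_nonneg[OF c, of "Q (pos_part v) (pos_part v) + Q (pos_part v) (neg_part v)"] F.V1 F.G1 F.K
    by (simp add: F.R1_def logterm_def)
  then obtain x where "\<bar>pos_part v x\<bar> > 1" using L_pos_imp by blast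
  then show "\<exists>x. v x > 1" by (auto simp: pos_part_def max_def split: if_splits)
  have "L (neg_part v) > 0"
    using R(2) mult_nonneg_nonneg[OF c, of "Q (pos_part v) (neg_part v) + Q (neg_part v) (neg_part v)"] F.V2 F.G2 F.K
    by (simp add: F.R2_def logterm_def)
  then obtain x where "\<bar>neg_part v x\<bar> > 1" using L_pos_imp by blast
  then show "\<exists>x. v x < - 1" by (auto simp: neg_part_def min_def split: if_splits)
qed

text \<open>Adding the two Nehari equations expresses \<open>L v\<close> by the quadratic and
  quartic terms. After substitution these have coefficients 1/2 - 1/p and 1/4 - 1/p, both positive
  because p > 4.\<close>

lemma M_set_coercive:
  assumes "v \<in> M_set w a b p h"
  shows "(1 / 2 - 1 / p) * V v v \<le> Jfun w a b p h v"
proof -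
  interpret sign_changing_fibre w h a b p W h0 v
    by (intro sign_changing_fibreI M_set_sign_changing assms)
  have R: "F.R1 1 1 + F.R2 1 1 = 0" using assms by (auto simp: in_M_set_iff)
  have Lv: "L v = (a + b * Q v v) * Q v v + V v v"
    using R L_comb[of 1 1] V_comb(3)[of 1 1] Q_comb[of 1 1]
    by (simp add: F.R1_def F.R2_def logterm_def F.G_def algebra_simps)
  have "P v \<ge> 0" unfolding P_def by (intro infsum_nonneg) auto
  then have "0 \<le> (1 / 2 - 1 / p) * (a * Q v v) + (1 / 4 - 1 / p) * (b * (Q v v)\<^sup>2) + 2 / p\<^sup>2 * P v"
    using p_gt Q_self_nonneg[of v] a_pos b_pos by (intro add_nonneg_nonneg mult_nonneg_nonneg) (auto simp: field_simps)
  moreover have "Jfun w a b p h v = (1 / 2 - 1 / p) * V v v +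
      ((1 / 2 - 1 / p) * (a * Q v v) + (1 / 4 - 1 / p) * (b * (Q v v)\<^sup>2) + 2 / p\<^sup>2 * P v)"
    unfolding Jfun_eq[OF fe(1)] Lv by (simp add: algebra_simps power2_eq_square add_divide_distrib)
  ultimately show ?thesis by linarith
qed

end

section \<open>Existence of a minimiser\<close>

text \<open>Fatou's lemma for sums: some finite partial sum of the limit already exceeds c, and
  finite sums pass to the limit.\<close>

lemma infsum_lsc:
  fixes f :: "nat \<Rightarrow> 'x \<Rightarrow> real"
  assumes nonneg: "\<And>n x. f n x \<ge> 0" and lim: "\<And>x. (\<lambda>n. f n x) \<longlonglongrightarrow> g x"
    and f: "\<And>n. f n summable_on UNIV" and g: "g summable_on UNIV" and c: "c < infsum g UNIV"
  shows "eventually (\<lambda>n. c < infsum (f n) UNIV) sequentially"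
proof -
  have "eventually (\<lambda>F. c < sum g F) (finite_subsets_at_top UNIV)"
    using order_tendstoD(1)[OF infsum_tendsto[OF g] c] .
  then obtain F where F: "finite F" "c < sum g F"
    by (auto simp: eventually_finite_subsets_at_top)
  have "(\<lambda>n. sum (f n) F) \<longlonglongrightarrow> sum g F"
    by (intro tendsto_sum lim)
  from order_tendstoD(1)[OF this F(2)] show ?thesis
  proof eventually_elim
    case (elim n)
    also have "sum (f n) F \<le> infsum (f n) UNIV"
      using F by (intro finite_sum_le_infsum f nonneg) auto
    finally show ?case .
  qed
qed

lemma open_box_3:
  fixes S :: "(real \<times> real \<times> real) set"
  assumes "open S" "(x, y, z) \<in> S"
  obtains r where "r > 0" "\<And>x' y' z'. \<bar>x' - x\<bar> \<le> r \<Longrightarrow> \<bar>y' - y\<bar> \<le> r \<Longrightarrow> \<bar>z' - z\<bar> \<le> r \<Longrightarrow> (x', y', z') \<in> S"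
proof -
  obtain A B where AB: "open A" "open B" "(x, y, z) \<in> A \<times> B" "A \<times> B \<subseteq> S"
    using open_prod_elim[OF assms] by metis
  then obtain C D where CD: "open C" "open D" "(y, z) \<in> C \<times> D" "C \<times> D \<subseteq> B"
    using open_prod_elim[of B "(y, z)"] by (metis mem_Times_iff snd_conv)
  have "\<exists>e>0. \<forall>u'. \<bar>u' - u\<bar> \<le> e \<longrightarrow> u' \<in> T" if "open T" "u \<in> T" for T :: "real set" and u
    using open_contains_cball[THEN iffD1, OF that(1)] that(2)
    by (force simp: subset_iff dist_real_def abs_minus_commute)
  then obtain e1 e2 e3 where e: "e1 > 0" "\<forall>u'. \<bar>u' - x\<bar> \<le> e1 \<longrightarrow> u' \<in> A" "e2 > 0" "\<forall>u'. \<bar>u' - y\<bar> \<le> e2 \<longrightarrow> u' \<in> C"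
     "e3 > 0" "\<forall>u'. \<bar>u' - z\<bar> \<le> e3 \<longrightarrow> u' \<in> D"
    using AB CD by (metis mem_Sigma_iff)
  show ?thesis
  proof (rule that[of "min e1 (min e2 e3)"])
    show "(x', y', z') \<in> S" if "\<bar>x' - x\<bar> \<le> min e1 (min e2 e3)" "\<bar>y' - y\<bar> \<le> min e1 (min e2 e3)" "\<bar>z' - z\<bar> \<le> min e1 (min e2 e3)" for x' y' z'
      using e that AB(4) CD(4) by (meson SigmaI min.boundedE subsetD)
  qed (use e in auto)
qed

lemma infsum_single_update:
  fixes f g :: "'x \<Rightarrow> real"
  assumes "f summable_on UNIV" "\<And>y. y \<noteq> x \<Longrightarrow> g y = f y"
  shows "infsum g UNIV = infsum f UNIV - f x + g x"
proof -
  have f: "f summable_on (UNIV - {x})"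
    by (rule summable_on_subset_banach[OF assms(1)]) auto
  then have g: "g summable_on (UNIV - {x})"
    by (rule summable_on_cong[THEN iffD1, rotated]) (use assms(2) in auto)
  have "infsum g (UNIV - {x}) = infsum f (UNIV - {x})"
    by (rule infsum_cong) (use assms(2) in auto)
  moreover have "infsum f (insert x (UNIV - {x})) = f x + infsum f (UNIV - {x})"
    by (rule infsum_insert[OF f]) auto
  moreover have "infsum g (insert x (UNIV - {x})) = g x + infsum g (UNIV - {x})"
    by (rule infsum_insert[OF g]) auto
  moreover have "insert x (UNIV - {x}) = UNIV" by auto
  ultimately show ?thesis by simp
qed

context kirchhoff
begin

lemma finite_energy_limit:
  assumes fe: "\<And>n. finite_energy (u n)" and K: "\<And>n. V (u n) (u n) \<le> K"
    and lim: "\<And>x. (\<lambda>n. u n x) \<longlonglongrightarrow> z x"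
  shows "finite_energy z"
proof -
  have "(\<Sum>x\<in>F. h x * (z x)\<^sup>2) \<le> K" if "finite F" for F
  proof (rule LIMSEQ_le_const2)
    show "(\<lambda>n. \<Sum>x\<in>F. h x * (u n x)\<^sup>2) \<longlonglongrightarrow> (\<Sum>x\<in>F. h x * (z x)\<^sup>2)"
      by (intro tendsto_intros lim)
    have "(\<Sum>x\<in>F. h x * (u n x)\<^sup>2) \<le> K" for n
    proof -
      have "(\<Sum>x\<in>F. h x * (u n x)\<^sup>2) \<le> (\<Sum>\<^sub>\<infinity>x. h x * (u n x)\<^sup>2)"
        using fe[of n] that h_pos by (intro finite_sum_le_infsum) (auto simp: finite_energy_def less_imp_le)
      also have "\<dots> = V (u n) (u n)" by (simp add: V_def power2_eq_square mult.assoc)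
      finally show ?thesis using K[of n] by linarith
    qed
    then show "\<exists>N. \<forall>n\<ge>N. (\<Sum>x\<in>F. h x * (u n x)\<^sup>2) \<le> K" by blast
  qed
  then show ?thesis
    unfolding finite_energy_def
    by (intro nonneg_bdd_above_summable_on bdd_aboveI[of _ K]) (auto simp: h_pos less_imp_le)
qed

lemma pointwise_le_V: 
  assumes "finite_energy u"
  shows "h x * (u x)\<^sup>2 \<le> V u u"
  using finite_sum_le_infsum[OF V_summable[OF assms assms], of "{x}"] h_pos
  by (simp add: V_def power2_eq_square mult.assoc less_imp_le)

text \<open>If |u x| were at least 1, the single term h x (u x)^2 would already exceed K.\<close>

lemma small_outside_sublevel:
  assumes "finite_energy u" "V u u \<le> K" "\<not> h x < K + 1"
  shows "\<bar>u x\<bar> < 1"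
proof (rule ccontr)
  assume "\<not> \<bar>u x\<bar> < 1"
  then have "1 \<le> (u x)\<^sup>2" by (simp add: abs_le_square_iff[of 1, simplified] not_less)
  then have "h x * 1 \<le> h x * (u x)\<^sup>2" using h_pos[of x] by (intro mult_left_mono) auto
  with pointwise_le_V[OF assms(1), of x] assms(2,3) show False by simp
qed

lemma Jfun_lsc:
  assumes fe: "\<And>n. finite_energy (u n)" and K: "\<And>n. V (u n) (u n) \<le> K"
    and lim: "\<And>x. (\<lambda>n. u n x) \<longlonglongrightarrow> z x"
    and J: "\<And>n. Jfun w a b p h (u n) \<le> c n" and c: "c \<longlonglongrightarrow> C"
  shows "Jfun w a b p h z \<le> C"
proof -
  have fz: "finite_energy z" by (rule finite_energy_limit[OF fe K lim])
  define F where "F = {x. h x < K + 1}"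
  have F: "finite F" unfolding F_def by (rule h_sublevel)
  \<comment> \<open>Minus the logarithmic term off \<open>F\<close>. It is nonnegative along the
    sequence, while the finite sum over \<open>F\<close> converges by continuity.\<close>
  define neglog where "neglog v x = (if x \<in> F then 0 else - logterm p (v x))" for v x
  define Lm where "Lm v = infsum (neglog v) UNIV" for v
  have small: "\<bar>u n x\<bar> < 1" if "x \<notin> F" for n x
    using small_outside_sublevel[OF fe K] that by (auto simp: F_def)
  have small': "\<bar>z x\<bar> \<le> 1" if "x \<notin> F" for x
    using LIMSEQ_le_const2[OF tendsto_rabs[OF lim[of x]], of 1] small[OF that] less_imp_le by blast
  have neglog_nonneg: "neglog (u n) x \<ge> 0" for n x
    using small[of x n] logterm_pos_imp[of p "u n x"] by (fastforce simp: neglog_def not_less)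
  have neglog_sum: "neglog v summable_on UNIV" if "finite_energy v" for v
    using nonlinear_summable(2)[OF that] unfolding neglog_def
    by (rule summable_on_abs_le[OF summable_on_iff_abs_summable_on_real[THEN iffD1]]) auto
  have L_split: "L v = (\<Sum>x\<in>F. logterm p (v x)) - Lm v" if "finite_energy v" for v
  proof -
    have fin: "(\<lambda>x. if x \<in> F then logterm p (v x) else 0) summable_on UNIV"
      by (rule finite_nonzero_values_imp_summable_on, rule finite_subset[OF _ F]) auto
    have "infsum (\<lambda>x. if x \<in> F then logterm p (v x) else 0) UNIV = infsum (\<lambda>x. logterm p (v x)) F"
      by (rule infsum_cong_neutral) auto
    moreover have "infsum (\<lambda>x. if x \<in> F then logterm p (v x) else 0) UNIV = infsum (\<lambda>x. logterm p (v x) + neglog v x) UNIV"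
      by (rule infsum_cong) (auto simp: neglog_def)
    moreover have "\<dots> = L v + Lm v"
      unfolding L_def Lm_def by (rule infsum_add[OF nonlinear_summable(2)[OF that] neglog_sum[OF that]])
    ultimately show ?thesis using F by simp
  qed
  have clog: "(\<lambda>n. logterm p (u n x)) \<longlonglongrightarrow> logterm p (z x)" for x
    using isCont_tendsto_compose[OF continuous_logterm[OF p_pos] lim] .
  have evL: "eventually (\<lambda>n. Lm z - e < Lm (u n)) sequentially" if "e > 0" for e
    unfolding Lm_def
    by (rule infsum_lsc[OF neglog_nonneg _ neglog_sum[OF fe] neglog_sum[OF fz]])
      (use that clog in \<open>auto simp: neglog_def Lm_def intro: tendsto_minus\<close>)
  have evP: "eventually (\<lambda>n. P z - e < P (u n)) sequentially" if "e > 0" for e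
    unfolding P_def
    by (rule infsum_lsc[OF _ _ nonlinear_summable(1)[OF fe] nonlinear_summable(1)[OF fz]])
      (use that p_pos in \<open>auto intro!: tendsto_powr2 tendsto_rabs lim\<close>)
  have evV: "eventually (\<lambda>n. V z z - e < V (u n) (u n)) sequentially" if "e > 0" for e
    unfolding V_def
    by (rule infsum_lsc[OF _ _ V_summable[OF fe fe] V_summable[OF fz fz]])
      (use that h_pos in \<open>auto intro!: tendsto_mult tendsto_const lim simp: mult.assoc less_imp_le\<close>)
  have evQ: "eventually (\<lambda>n. Q z z - e < Q (u n) (u n)) sequentially" if "e > 0" for e
  proof -
    note ss = fe[THEN finite_energy_square_summable(1)] fz[THEN finite_energy_square_summable(1)]
    \<comment> \<open>The factor 2 undoes the 1/2 in the definition of \<open>Q\<close>.\<close>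
    have "eventually (\<lambda>n. (\<Sum>\<^sub>\<infinity>(x, y). ker x y * (z x - z y) * (z x - z y)) - 2 * e
        < (\<Sum>\<^sub>\<infinity>(x, y). ker x y * (u n x - u n y) * (u n x - u n y))) sequentially"
      by (rule infsum_lsc[OF _ _ pair_summable[OF ss(1) ss(1)] pair_summable[OF ss(2) ss(2)]])
        (use that ker_nonneg in \<open>auto intro!: tendsto_mult tendsto_diff tendsto_const lim simp: mult.assoc\<close>)
    then show ?thesis
      by eventually_elim (simp add: Q_def)
  qed
  \<comment> \<open>A lower bound for the energy of u n that gives up e in each limiting term;
    \<open>max 0\<close> makes squaring monotone. Finally e tends to 0.\<close>
  define g where "g e = a / 2 * (Q z z - e) + (V z z - e) / 2 + b / 4 * (max 0 (Q z z - e))\<^sup>2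
    + 2 / p\<^sup>2 * (P z - e) + 1 / p * (Lm z - e)" for e
  have "g e - 1 / p * (\<Sum>x\<in>F. logterm p (z x)) \<le> C" if "e > 0" for e
  proof (rule tendsto_le[OF sequentially_bot c])
    show "(\<lambda>n. g e - 1 / p * (\<Sum>x\<in>F. logterm p (u n x))) \<longlonglongrightarrow> g e - 1 / p * (\<Sum>x\<in>F. logterm p (z x))"
      by (intro tendsto_intros clog)
    show "eventually (\<lambda>n. g e - 1 / p * (\<Sum>x\<in>F. logterm p (u n x)) \<le> c n) sequentially"
      using evL[OF that] evP[OF that] evV[OF that] evQ[OF that]
    proof eventually_elim
      case (elim n)
      have q: "(max 0 (Q z z - e))\<^sup>2 \<le> (Q (u n) (u n))\<^sup>2"
        using elim Q_self_nonneg[of "u n"] by (intro power_mono) auto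
      have "g e - 1 / p * (\<Sum>x\<in>F. logterm p (u n x)) \<le>
        a / 2 * Q (u n) (u n) + V (u n) (u n) / 2 + b / 4 * (Q (u n) (u n))\<^sup>2
          + 2 / p\<^sup>2 * P (u n) + 1 / p * Lm (u n) - 1 / p * (\<Sum>x\<in>F. logterm p (u n x))"
        unfolding g_def using elim a_pos b_pos p_pos q
        by (intro diff_mono add_mono mult_left_mono divide_right_mono order_refl) auto
      also have "\<dots> = Jfun w a b p h (u n)"
        unfolding Jfun_eq[OF fe] L_split[OF fe] by (simp add: diff_divide_distrib)
      finally show ?case using J[of n] by linarith
    qed
  qed
  moreover have "((\<lambda>e. g e - 1 / p * (\<Sum>x\<in>F. logterm p (z x))) \<longlongrightarrow> g 0 - 1 / p * (\<Sum>x\<in>F. logterm p (z x))) (at_right 0)"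
    unfolding g_def by (intro tendsto_intros) auto
  ultimately have "g 0 - 1 / p * (\<Sum>x\<in>F. logterm p (z x)) \<le> C"
    by (intro tendsto_upperbound[where F = "at_right (0::real)"]) (auto simp: eventually_at_filter)
  moreover have "Jfun w a b p h z = g 0 - 1 / p * (\<Sum>x\<in>F. logterm p (z x))"
    unfolding Jfun_eq[OF fz] L_split[OF fz] g_def using Q_self_nonneg[of z] by (simp add: diff_divide_distrib)
  ultimately show ?thesis by simp
qed

text \<open>Gives scaled minimising sequences a uniform bound on the potential energy.\<close>

lemma V_comb_le:
  assumes "finite_energy v" "s \<ge> 0" "t \<ge> 0"
  shows "V (comb v s t) (comb v s t) \<le> (max s t)\<^sup>2 * V v v"
proof -
  have "\<bar>comb v s t x\<bar> \<le> max s t * \<bar>v x\<bar>" for x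
    using assms(2,3)
    by (cases "v x > 0") (auto simp: comb_def pos_part_def neg_part_def max_def min_def abs_mult
        intro: mult_right_mono mult_right_mono_neg)
  then have "(comb v s t x)\<^sup>2 \<le> (max s t)\<^sup>2 * (v x)\<^sup>2" for x
    using power_mono[of "\<bar>comb v s t x\<bar>" "max s t * \<bar>v x\<bar>" 2] by (simp add: power_mult_distrib)
  then have "h x * (comb v s t x)\<^sup>2 \<le> h x * ((max s t)\<^sup>2 * (v x)\<^sup>2)" for x
    using h_pos[of x] by (intro mult_left_mono) (auto simp: less_imp_le)
  then have le: "h x * comb v s t x * comb v s t x \<le> (max s t)\<^sup>2 * (h x * v x * v x)" for x
    by (simp add: power2_eq_square mult_ac)
  show ?thesis
    unfolding V_def infsum_cmult_right'[symmetric]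
    by (intro infsum_mono le summable_on_cmult_right V_summable finite_energy_comb assms)
qed

lemma M_set_nonempty: "M_set w a b p h \<noteq> {}"
proof -
  \<comment> \<open>Two point masses of opposite sign; the origin and the all-ones vector differ in
    every dimension. Projecting this function gives an element.\<close>
  define u :: "int^'n \<Rightarrow> real" where "u x = (if x = 0 then 1 else if x = (\<chi> i. 1) then - 1 else 0)" for x
  have "(0 :: int^'n) \<noteq> (\<chi> i. 1)" by (simp add: vec_eq_iff)
  then have "u 0 > 0" "u (\<chi> i. 1) < 0" by (auto simp: u_def)
  moreover have "finite {x. u x \<noteq> 0}"
    by (rule finite_subset[of _ "{0, (\<chi> i. 1)}"]) (auto simp: u_def)
  ultimately have "sign_changing u"
    using finite_energy_finite_support by (auto simp: sign_changing_iff)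
  from projection_to_M_set[OF this] show ?thesis by auto
qed

lemma minimiser_exists:
  obtains v where "v \<in> M_set w a b p h" "\<And>u. u \<in> M_set w a b p h \<Longrightarrow> Jfun w a b p h v \<le> Jfun w a b p h u"
proof -
  let ?J = "Jfun w a b p h" and ?M = "M_set w a b p h"
  define C where "C = Inf (?J ` ?M)"
  have p2: "1 / 2 - 1 / p > 0" using p_gt by (simp add: field_simps)
  have "0 \<le> ?J v" if "v \<in> ?M" for v
    using mult_nonneg_nonneg[OF less_imp_le[OF p2] V_self_nonneg[of v]] M_set_coercive[OF that] by linarith
  then have bdd: "bdd_below (?J ` ?M)" by (auto intro: bdd_belowI[of _ 0])
  have "\<exists>v. v \<in> ?M \<and> ?J v < C + 1 / real (Suc n)" for n
    using cInf_lessD[of "?J ` ?M" "C + 1 / real (Suc n)"] M_set_nonempty by (auto simp: C_def)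
  then obtain v where vM: "\<And>n. v n \<in> ?M" and vJ: "\<And>n. ?J (v n) < C + 1 / real (Suc n)"
    by metis
  have fe: "finite_energy (v n)" for n
    using M_set_sign_changing[OF vM] by (simp add: sign_changing_iff)
  \<comment> \<open>The bound that coercivity gives at energy level C + 1.\<close>
  define K where "K = (C + 1) / (1 / 2 - 1 / p)"
  have VK: "V (v n) (v n) \<le> K" for n
  proof -
    have "(1 / 2 - 1 / p) * V (v n) (v n) \<le> C + 1 / real (Suc n)"
      using M_set_coercive[OF vM[of n]] vJ[of n] by linarith
    also have "\<dots> \<le> C + 1" by simp
    finally show ?thesis using p2 by (simp add: K_def pos_le_divide_eq mult.commute)
  qed
  have bound: "norm (v n x) \<le> sqrt (K / h0)" for n x
  proof -
    have "h0 * (v n x)\<^sup>2 \<le> h x * (v n x)\<^sup>2" using h_ge by (intro mult_right_mono) auto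
    also have "\<dots> \<le> K" using pointwise_le_V[OF fe] VK[of n] order_trans by blast
    finally have "(v n x)\<^sup>2 \<le> K / h0" using h0_pos by (simp add: pos_le_divide_eq mult.commute)
    then show ?thesis by (metis real_norm_def real_sqrt_abs real_sqrt_le_mono)
  qed
  \<comment> \<open>The lattice is countable, so a diagonal argument yields one subsequence that
    converges at every point.\<close>
  obtain k where k: "strict_mono k" "\<And>x. \<exists>l. (\<lambda>n. v (k n) x) \<longlonglongrightarrow> l"
    using function_convergent_subsequence[of UNIV v, OF _ bound] by auto
  then obtain z where z: "\<And>x. (\<lambda>n. v (k n) x) \<longlonglongrightarrow> z x" by metis
  define F where "F = {x. h x < K + 1}"
  have F: "finite F" unfolding F_def by (rule h_sublevel)
  have outside: "\<bar>v n x\<bar> < 1" if "x \<notin> F" for n x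
    using small_outside_sublevel[OF fe VK] that by (auto simp: F_def)
  \<comment> \<open>Otherwise, \<open>F\<close> being finite, some v (k n) stays below 1 on
    \<open>F\<close>. Off \<open>F\<close> it does so too, although every element of the Nehari set
    exceeds 1 somewhere.\<close>
  have "\<exists>x\<in>F. z x \<ge> 1"
  proof (rule ccontr)
    assume "\<not> ?thesis"
    then have "\<forall>x\<in>F. eventually (\<lambda>n. v (k n) x < 1) sequentially"
      using order_tendstoD(2)[OF z] by (simp add: not_le)
    then have "eventually (\<lambda>n. \<forall>x\<in>F. v (k n) x < 1) sequentially"
      using F by (simp add: eventually_ball_finite_distrib)
    then obtain n where "\<forall>x\<in>F. v (k n) x < 1" by (auto simp: eventually_sequentially)
    moreover obtain x where "v (k n) x > 1" using M_set_large_values(1)[OF vM] by blast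
    ultimately show False using outside[of x "k n"] by force
  qed
  moreover have "\<exists>x\<in>F. z x \<le> - 1"
  proof (rule ccontr)
    assume "\<not> ?thesis"
    then have "\<forall>x\<in>F. eventually (\<lambda>n. v (k n) x > - 1) sequentially"
      using order_tendstoD(1)[OF z] by (simp add: not_le)
    then have "eventually (\<lambda>n. \<forall>x\<in>F. v (k n) x > - 1) sequentially"
      using F by (simp add: eventually_ball_finite_distrib)
    then obtain n where "\<forall>x\<in>F. v (k n) x > - 1" by (auto simp: eventually_sequentially)
    moreover obtain x where "v (k n) x < - 1" using M_set_large_values(2)[OF vM] by blast
    ultimately show False using outside[of x "k n"] by force
  qed
  moreover have fz: "finite_energy z"
    by (rule finite_energy_limit[of "\<lambda>n. v (k n)", OF fe VK z])
  ultimately have "sign_changing z"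
    unfolding sign_changing_iff
    by (metis less_le_trans le_less_trans zero_less_one neg_less_0_iff_less)
  then obtain s t where st: "s > 0" "t > 0" and in_M: "comb z s t \<in> ?M"
    using projection_to_M_set by blast
  \<comment> \<open>The limit itself need not satisfy the Nehari equations. Scaling the sequence by
    the limit's s and t preserves pointwise convergence and cannot raise the energy, since each v (k
    n) is maximal on its own fibre.\<close>
  have "?J (comb z s t) \<le> C"
  proof (rule Jfun_lsc)
    show "finite_energy (comb (v (k n)) s t)" for n by (rule finite_energy_comb[OF fe])
    show "V (comb (v (k n)) s t) (comb (v (k n)) s t) \<le> (max s t)\<^sup>2 * K" for n
      using V_comb_le[OF fe[of "k n"], of s t] mult_left_mono[OF VK[of "k n"], of "(max s t)\<^sup>2"] st by simp
    show "(\<lambda>n. comb (v (k n)) s t x) \<longlonglongrightarrow> comb z s t x" for x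
      unfolding comb_def pos_part_def neg_part_def by (intro tendsto_intros z)
    show "?J (comb (v (k n)) s t) \<le> C + 1 / real (Suc n)" for n
    proof -
      have "?J (comb (v (k n)) s t) \<le> ?J (v (k n))"
        using st by (intro Jfun_comb_le vM) auto
      also have "\<dots> \<le> C + 1 / real (Suc (k n))" using vJ less_imp_le by blast
      also have "\<dots> \<le> C + 1 / real (Suc n)"
        using seq_suble[OF k(1), of n] by (simp add: frac_le)
      finally show ?thesis .
    qed
    show "(\<lambda>n. C + 1 / real (Suc n)) \<longlonglongrightarrow> C" by real_asymp
  qed
  then have "?J (comb z s t) \<le> ?J u" if "u \<in> ?M" for u
    using cInf_lower[OF imageI[OF that, of ?J] bdd] by (simp add: C_def)
  with in_M show ?thesis using that by blast
qed

end

section \<open>The minimiser is critical\<close>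

context kirchhoff
begin

section \<open>Point masses and the energy along a shift at one point\<close>

definition unit_at :: "int^'n \<Rightarrow> int^'n \<Rightarrow> real" where
  "unit_at x y = (if y = x then 1 else 0)"

lemma infsum_unit_at: "(\<Sum>\<^sub>\<infinity>y. f y * unit_at x y) = f x"
proof -
  have "(\<Sum>\<^sub>\<infinity>y. f y * unit_at x y) = infsum f {x}"
    by (rule infsum_cong_neutral) (auto simp: unit_at_def)
  then show ?thesis by simp
qed

lemma finite_energy_unit_at: "finite_energy (unit_at x)"
  by (rule finite_energy_finite_support, rule finite_subset[of _ "{x}"]) (auto simp: unit_at_def)

lemma finite_energy_shift: "finite_energy z \<Longrightarrow> finite_energy (\<lambda>y. z y + \<eta> * unit_at x y)"
  using finite_energy_lincomb[of z "unit_at x" 1 \<eta>] finite_energy_unit_at by simp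

lemma dJ_unit_at:
  assumes "finite_energy u"
  shows "dJ w a b p h u (unit_at x) = (a + b * Q u u) * Q u (unit_at x) + h x * u x - fnl p (u x)"
  using dJ_eq[OF assms finite_energy_unit_at] by (simp add: V_def infsum_unit_at)

lemma Q_shift:
  assumes "finite_energy z"
  shows "Q (\<lambda>y. z y + \<eta> * unit_at x y) (unit_at x) = Q z (unit_at x) + \<eta> * Q (unit_at x) (unit_at x)"
    and "Q (\<lambda>y. z y + \<eta> * unit_at x y) (\<lambda>y. z y + \<eta> * unit_at x y)
      = Q z z + 2 * \<eta> * Q z (unit_at x) + \<eta>\<^sup>2 * Q (unit_at x) (unit_at x)"
proof -
  note ss = finite_energy_square_summable(1)[OF assms] finite_energy_square_summable(1)[OF finite_energy_unit_at[of x]]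
    finite_energy_square_summable(1)[OF finite_energy_shift[OF assms, of \<eta> x]]
  show 1: "Q (\<lambda>y. z y + \<eta> * unit_at x y) (unit_at x) = Q z (unit_at x) + \<eta> * Q (unit_at x) (unit_at x)"
    using Q_add_left[OF ss(2) ss(1) ss(2), of 1 \<eta>] by simp
  have "Q (\<lambda>y. z y + \<eta> * unit_at x y) z = Q z z + \<eta> * Q z (unit_at x)"
    using Q_add_left[OF ss(1) ss(1) ss(2), of 1 \<eta>] by (simp add: Q_sym[of "unit_at x" z])
  with 1 show "Q (\<lambda>y. z y + \<eta> * unit_at x y) (\<lambda>y. z y + \<eta> * unit_at x y)
      = Q z z + 2 * \<eta> * Q z (unit_at x) + \<eta>\<^sup>2 * Q (unit_at x) (unit_at x)"
    using Q_add_right[OF ss(3) ss(1) ss(2), of 1 \<eta>] by (simp add: algebra_simps power2_eq_square)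
qed

text \<open>Changing one value alters each local sum in one term only. The energy becomes an
  explicit function of \<eta>, and differentiating it is one-variable calculus.\<close>

lemma Jfun_shift:
  assumes "finite_energy z"
  shows "Jfun w a b p h (\<lambda>y. z y + \<eta> * unit_at x y) =
    a / 2 * (Q z z + 2 * \<eta> * Q z (unit_at x) + \<eta>\<^sup>2 * Q (unit_at x) (unit_at x))
    + (V z z - h x * (z x)\<^sup>2 + h x * (z x + \<eta>)\<^sup>2) / 2
    + b / 4 * (Q z z + 2 * \<eta> * Q z (unit_at x) + \<eta>\<^sup>2 * Q (unit_at x) (unit_at x))\<^sup>2
    + 2 / p\<^sup>2 * (P z - \<bar>z x\<bar> powr p) - 1 / p * (L z - logterm p (z x))
    + (2 / p\<^sup>2 * \<bar>z x + \<eta>\<bar> powr p - 1 / p * logterm p (z x + \<eta>))"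
proof -
  let ?u = "\<lambda>y. z y + \<eta> * unit_at x y"
  have Vu: "V ?u ?u = V z z - h x * (z x)\<^sup>2 + h x * (z x + \<eta>)\<^sup>2"
    using infsum_single_update[OF V_summable[OF assms assms], of x "\<lambda>y. h y * ?u y * ?u y"]
    by (simp add: V_def unit_at_def power2_eq_square mult.assoc)
  have Pu: "P ?u = P z - \<bar>z x\<bar> powr p + \<bar>z x + \<eta>\<bar> powr p"
    using infsum_single_update[OF nonlinear_summable(1)[OF assms], of x "\<lambda>y. \<bar>?u y\<bar> powr p"]
    by (simp add: P_def unit_at_def)
  have Lu: "L ?u = L z - logterm p (z x) + logterm p (z x + \<eta>)"
    using infsum_single_update[OF nonlinear_summable(2)[OF assms], of x "\<lambda>y. logterm p (?u y)"]
    by (simp add: L_def unit_at_def)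
  show ?thesis
    unfolding Jfun_eq[OF finite_energy_shift[OF assms]] Q_shift[OF assms] Vu Pu Lu
    by (simp only: distrib_left right_diff_distrib)
qed

lemma Jfun_shift_deriv:
  assumes "finite_energy z" "z x + \<eta> \<noteq> 0"
  shows "((\<lambda>\<eta>. Jfun w a b p h (\<lambda>y. z y + \<eta> * unit_at x y)) has_real_derivative
    dJ w a b p h (\<lambda>y. z y + \<eta> * unit_at x y) (unit_at x)) (at \<eta>)"
proof -
  have "((\<lambda>\<eta>. 2 / p\<^sup>2 * \<bar>z x + \<eta>\<bar> powr p - 1 / p * logterm p (z x + \<eta>)) has_real_derivative
      - fnl p (z x + \<eta>) * 1) (at \<eta>)"
    by (rule DERIV_chain2[where g = "\<lambda>\<eta>. z x + \<eta>", OF powr_logterm_deriv[OF assms(2) p_pos]]) (auto intro!: derivative_eq_intros)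
  then have *: "((\<lambda>\<eta>. 2 / p\<^sup>2 * \<bar>z x + \<eta>\<bar> powr p - 1 / p * logterm p (z x + \<eta>)) has_real_derivative
      - fnl p (z x + \<eta>)) (at \<eta>)" by simp
  define q0 q1 q2 where "q0 = Q z z" and "q1 = Q z (unit_at x)" and "q2 = Q (unit_at x) (unit_at x)"
  have d1: "((\<lambda>\<eta>. q0 + 2 * \<eta> * q1 + \<eta>\<^sup>2 * q2) has_real_derivative 2 * q1 + 2 * \<eta> * q2) (at \<eta>)"
    by (auto intro!: derivative_eq_intros)
  have d2: "((\<lambda>\<eta>. (q0 + 2 * \<eta> * q1 + \<eta>\<^sup>2 * q2)\<^sup>2) has_real_derivative
      2 * (q0 + 2 * \<eta> * q1 + \<eta>\<^sup>2 * q2) * (2 * q1 + 2 * \<eta> * q2)) (at \<eta>)"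
    by (rule DERIV_cong[OF DERIV_power[OF d1, of 2]]) (simp add: algebra_simps)
  have d3: "((\<lambda>\<eta>. V z z - h x * (z x)\<^sup>2 + h x * (z x + \<eta>)\<^sup>2) has_real_derivative 2 * (h x * (z x + \<eta>))) (at \<eta>)"
    by (auto intro!: derivative_eq_intros)
  have "((\<lambda>\<eta>. Jfun w a b p h (\<lambda>y. z y + \<eta> * unit_at x y)) has_real_derivative
    a / 2 * (2 * q1 + 2 * \<eta> * q2) + 2 * (h x * (z x + \<eta>)) / 2
      + b / 4 * (2 * (q0 + 2 * \<eta> * q1 + \<eta>\<^sup>2 * q2) * (2 * q1 + 2 * \<eta> * q2)) + 0 - 0 + - fnl p (z x + \<eta>)) (at \<eta>)"
    unfolding Jfun_shift[OF assms(1)] q0_def[symmetric] q1_def[symmetric] q2_def[symmetric]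
    by (intro DERIV_add DERIV_diff DERIV_cmult DERIV_cdivide DERIV_const d1 d2 d3 *)
  moreover have "dJ w a b p h (\<lambda>y. z y + \<eta> * unit_at x y) (unit_at x) =
    a / 2 * (2 * q1 + 2 * \<eta> * q2) + 2 * (h x * (z x + \<eta>)) / 2
      + b / 4 * (2 * (q0 + 2 * \<eta> * q1 + \<eta>\<^sup>2 * q2) * (2 * q1 + 2 * \<eta> * q2)) + 0 - 0 + - fnl p (z x + \<eta>)"
    unfolding dJ_unit_at[OF finite_energy_shift[OF assms(1)]] Q_shift[OF assms(1)]
    by (simp add: q0_def q1_def q2_def unit_at_def algebra_simps)
  ultimately show ?thesis by simp
qed

lemma continuous_Jfun_shift:
  assumes "finite_energy z"
  shows "isCont (\<lambda>\<eta>. Jfun w a b p h (\<lambda>y. z y + \<eta> * unit_at x y)) \<eta>"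
proof -
  have "isCont (\<lambda>\<eta>. z x + \<eta>) \<eta>" by (intro continuous_intros)
  from isCont_o2[OF this continuous_logterm[OF p_pos]]
  have c1: "(\<lambda>\<eta>. logterm p (z x + \<eta>)) \<midarrow>\<eta>\<rightarrow> logterm p (z x + \<eta>)"
    by (simp only: isCont_def)
  have c2: "(\<lambda>\<eta>. \<bar>z x + \<eta>\<bar> powr p) \<midarrow>\<eta>\<rightarrow> \<bar>z x + \<eta>\<bar> powr p"
    using p_pos by (intro tendsto_powr2 tendsto_intros) auto
  show ?thesis
    unfolding Jfun_shift[OF assms] isCont_def
    by (intro tendsto_add tendsto_diff tendsto_mult tendsto_power tendsto_divide tendsto_const tendsto_ident_at c1 c2)
      (auto simp: p_nonzero)
qed

text \<open>The derivative is a polynomial in s, t, \<eta> minus \<open>fnl p\<close> of such a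
  polynomial. Joint continuity provides a whole box on which it keeps its sign.\<close>

lemma dJ_shift_comb_continuous:
  assumes "sign_changing v"
  shows "continuous_on UNIV (\<lambda>(s, t, \<eta>). dJ w a b p h (\<lambda>y. comb v s t y + \<eta> * unit_at x y) (unit_at x))"
proof -
  interpret sign_changing_fibre w h a b p W h0 v
    by (intro sign_changing_fibreI assms)
  define q1 q2 q3 where "q1 = Q (pos_part v) (unit_at x)" and "q2 = Q (neg_part v) (unit_at x)"
    and "q3 = Q (unit_at x) (unit_at x)"
  note ss = fe[THEN finite_energy_square_summable(1)] finite_energy_square_summable(1)[OF finite_energy_unit_at[of x]]
  have q: "Q (comb v s t) (unit_at x) = s * q1 + t * q2" for s t
    using Q_add_left[OF ss(4) ss(2) ss(3), of s t] by (simp add: comb_def q1_def q2_def)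
  have eq: "(\<lambda>(s, t, \<eta>). dJ w a b p h (\<lambda>y. comb v s t y + \<eta> * unit_at x y) (unit_at x)) =
    (\<lambda>z. (a + b * (F.G (fst z) (fst (snd z)) + 2 * snd (snd z) * (fst z * q1 + fst (snd z) * q2) + (snd (snd z))\<^sup>2 * q3))
      * (fst z * q1 + fst (snd z) * q2 + snd (snd z) * q3)
      + h x * (fst z * pos_part v x + fst (snd z) * neg_part v x + snd (snd z))
      - fnl p (fst z * pos_part v x + fst (snd z) * neg_part v x + snd (snd z)))"
    unfolding dJ_unit_at[OF finite_energy_shift[OF finite_energy_comb[OF fe(1)]]]
      Q_shift[OF finite_energy_comb[OF fe(1)]] q Q_comb q3_def[symmetric]
    by (auto simp: unit_at_def comb_def fun_eq_iff)
  have cf: "continuous_on UNIV (fnl p)"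
    by (intro continuous_at_imp_continuous_on ballI continuous_fnl p_gt_2)
  show ?thesis
    unfolding eq F.G_def by (intro continuous_intros continuous_on_compose2[OF cf]) auto
qed

text \<open>The point x contributes nothing to the negative part before or after the shift, so the
  factor s acts on the shift as well. If v x = 0, the point joins the positive part.\<close>

lemma comb_unit_shift_pos:
  assumes "v x \<ge> 0" "v x + \<epsilon> > 0"
  shows "comb (\<lambda>y. v y + \<epsilon> * unit_at x y) s t = (\<lambda>y. comb v s t y + (s * \<epsilon>) * unit_at x y)"
    and "comb v s t x = s * v x"
proof -
  show "comb v s t x = s * v x"
    using assms(1) by (simp add: comb_def pos_part_def neg_part_def)
  have "comb (\<lambda>y. v y + \<epsilon> * unit_at x y) s t y = comb v s t y + (s * \<epsilon>) * unit_at x y" for y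
    using assms by (cases "y = x") (simp_all add: comb_def pos_part_def neg_part_def unit_at_def distrib_left)
  then show "comb (\<lambda>y. v y + \<epsilon> * unit_at x y) s t = (\<lambda>y. comb v s t y + (s * \<epsilon>) * unit_at x y)" ..
qed

lemma comb_unit_shift_neg:
  assumes "v x \<le> 0" "v x + \<epsilon> < 0"
  shows "comb (\<lambda>y. v y + \<epsilon> * unit_at x y) s t = (\<lambda>y. comb v s t y + (t * \<epsilon>) * unit_at x y)"
    and "comb v s t x = t * v x"
proof -
  show "comb v s t x = t * v x"
    using assms(1) by (simp add: comb_def pos_part_def neg_part_def)
  have "comb (\<lambda>y. v y + \<epsilon> * unit_at x y) s t y = comb v s t y + (t * \<epsilon>) * unit_at x y" for y
    using assms by (cases "y = x") (simp_all add: comb_def pos_part_def neg_part_def unit_at_def distrib_left)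
  then show "comb (\<lambda>y. v y + \<epsilon> * unit_at x y) s t = (\<lambda>y. comb v s t y + (t * \<epsilon>) * unit_at x y)" ..
qed

text \<open>The derivative formula requires a nonzero value at x. If c is nonzero the shift is too
  short to reach 0; if c = 0 the value vanishes only at the start, where continuity
  suffices.\<close>

lemma Jfun_decreases_along_shift:
  assumes z: "finite_energy z" and m: "m > 0" and zx: "z x = m * c"
    and c: "c \<noteq> 0 \<and> \<bar>\<epsilon>\<bar> < \<bar>c\<bar> \<or> c = 0 \<and> \<epsilon> \<noteq> 0"
    and neg: "\<And>\<eta>. \<bar>\<eta>\<bar> \<le> m * \<bar>\<epsilon>\<bar> \<Longrightarrow> \<epsilon> * dJ w a b p h (\<lambda>y. z y + \<eta> * unit_at x y) (unit_at x) < 0"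
    and eps: "\<epsilon> \<noteq> 0"
  shows "Jfun w a b p h (\<lambda>y. z y + (m * \<epsilon>) * unit_at x y) < Jfun w a b p h z"
proof -
  let ?f = "\<lambda>\<theta>. Jfun w a b p h (\<lambda>y. z y + (\<theta> * (m * \<epsilon>)) * unit_at x y)"
  have "?f 1 < ?f 0"
  proof (rule DERIV_neg_imp_decreasing_open[OF zero_less_one])
    fix \<theta> :: real assume th: "0 < \<theta>" "\<theta> < 1"
    have "\<theta> * \<bar>\<epsilon>\<bar> < \<bar>\<epsilon>\<bar>" using th eps by simp
    then have "c + \<theta> * \<epsilon> \<noteq> 0"
      using c th by (auto simp: abs_mult dest!: eq_neg_iff_add_eq_0[THEN iffD2])
    then have "m * (c + \<theta> * \<epsilon>) \<noteq> 0" using m by simp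
    then have ne: "z x + \<theta> * (m * \<epsilon>) \<noteq> 0" by (simp add: zx algebra_simps)
    have "(?f has_real_derivative dJ w a b p h (\<lambda>y. z y + (\<theta> * (m * \<epsilon>)) * unit_at x y) (unit_at x) * (m * \<epsilon>)) (at \<theta>)"
      by (rule DERIV_chain2[where g = "\<lambda>\<theta>. \<theta> * (m * \<epsilon>)", OF Jfun_shift_deriv[OF z ne]]) (auto intro!: derivative_eq_intros)
    moreover have "dJ w a b p h (\<lambda>y. z y + (\<theta> * (m * \<epsilon>)) * unit_at x y) (unit_at x) * (m * \<epsilon>) < 0"
    proof -
      have "\<bar>\<theta> * (m * \<epsilon>)\<bar> \<le> m * \<bar>\<epsilon>\<bar>"
        using th m by (simp add: abs_mult mult_left_le_one_le)
      from mult_pos_neg[OF m neg[OF this]] show ?thesis by (simp add: mult_ac)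
    qed
    ultimately show "\<exists>y. (?f has_real_derivative y) (at \<theta>) \<and> y < 0" by blast
  next
    show "continuous_on {0..1} ?f"
      by (intro continuous_at_imp_continuous_on ballI isCont_o2[OF _ continuous_Jfun_shift[OF z]] continuous_intros)
  qed
  then show ?thesis by simp
qed

lemma minimiser_critical_unit:
  assumes vM: "v \<in> M_set w a b p h"
    and min: "\<And>u. u \<in> M_set w a b p h \<Longrightarrow> Jfun w a b p h v \<le> Jfun w a b p h u"
  shows "dJ w a b p h v (unit_at x) = 0"
proof (rule ccontr)
  let ?J = "Jfun w a b p h" and ?M = "M_set w a b p h"
  define D where "D = dJ w a b p h v (unit_at x)"
  assume "dJ w a b p h v (unit_at x) \<noteq> 0"
  then have D: "D \<noteq> 0" by (simp add: D_def)
  have sc: "sign_changing v" by (rule M_set_sign_changing[OF vM])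
  then have fe: "finite_energy v" by (simp add: sign_changing_iff)
  define DD where "DD = (\<lambda>(s, t, \<eta>). dJ w a b p h (\<lambda>y. comb v s t y + \<eta> * unit_at x y) (unit_at x))"
  have "open {z. D * DD z > 0}"
    unfolding DD_def
    by (intro open_Collect_less continuous_on_const continuous_on_mult dJ_shift_comb_continuous sc)
  moreover have "(1, 1, 0) \<in> {z. D * DD z > 0}"
    using D by (simp add: DD_def D_def zero_less_mult_iff linorder_neq_iff disj_commute)
  ultimately obtain r' where r': "r' > 0" and pos': "\<And>s t \<eta>. \<bar>s - 1\<bar> \<le> r' \<Longrightarrow> \<bar>t - 1\<bar> \<le> r' \<Longrightarrow> \<bar>\<eta> - 0\<bar> \<le> r' \<Longrightarrow> (s, t, \<eta>) \<in> {z. D * DD z > 0}"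
    using open_box_3 by blast
  \<comment> \<open>At most 1/2, so that the square lies in the open quadrant and its parameters
    stay below 2.\<close>
  define r where "r = min r' (1 / 2)"
  have r: "0 < r" "r \<le> 1 / 2" using r' by (auto simp: r_def)
  have pos: "D * DD (s, t, \<eta>) > 0" if "\<bar>s - 1\<bar> \<le> r" "\<bar>t - 1\<bar> \<le> r" "\<bar>\<eta>\<bar> \<le> r" for s t \<eta>
    using pos'[of s t \<eta>] that by (auto simp: r_def)
  define Sq where "Sq = {1 - r..1 + r} \<times> {1 - r..1 + r}"
  \<comment> \<open>The boundary of the square; by strict maximality at (1,1) the fibre energy of v
    stays below the energy of v there.\<close>
  define B where "B = Sq - {1 - r<..<1 + r} \<times> {1 - r<..<1 + r}"
  have Sq: "compact Sq" "Sq \<noteq> {}" "Sq \<subseteq> {0..} \<times> {0..}" "(1, 1) \<in> Sq"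
    using r by (auto simp: Sq_def intro!: compact_Times)
  have B: "compact B" "B \<noteq> {}" "B \<subseteq> {0..} \<times> {0..}" "(1, 1) \<notin> B"
  proof -
    show "compact B" unfolding B_def by (intro compact_diff Sq open_Times) auto
    have "(1 - r, 1) \<in> B" using r by (auto simp: B_def Sq_def)
    then show "B \<noteq> {}" by blast
    show "B \<subseteq> {0..} \<times> {0..}" using Sq by (auto simp: B_def)
    show "(1, 1) \<notin> B" using r by (auto simp: B_def)
  qed
  obtain zB where zB: "zB \<in> B" "\<And>z. z \<in> B \<Longrightarrow> ?J (comb v (fst z) (snd z)) \<le> ?J (comb v (fst zB) (snd zB))"
    using continuous_attains_sup[OF B(1,2) continuous_on_subset[OF continuous_Jfun_comb[OF sc] B(3)]] by blast
  have gap: "?J (comb v (fst zB) (snd zB)) < ?J v"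
  proof (rule Jfun_comb_le(2)[OF vM])
    show "0 \<le> fst zB" "0 \<le> snd zB" using zB(1) B(3) by auto
    show "(fst zB, snd zB) \<noteq> (1, 1)" using zB(1) B(4) by auto
  qed
  have "(\<lambda>\<eta>. ?J (\<lambda>y. v y + \<eta> * unit_at x y)) \<midarrow>0\<rightarrow> ?J v"
    using continuous_Jfun_shift[OF fe, where x = x and \<eta> = 0] by (simp add: isCont_def)
  from order_tendstoD(1)[OF this gap]
  obtain d where d: "d > 0" "\<And>\<eta>. \<eta> \<noteq> 0 \<Longrightarrow> \<bar>\<eta>\<bar> < d \<Longrightarrow> ?J (comb v (fst zB) (snd zB)) < ?J (\<lambda>y. v y + \<eta> * unit_at x y)"
    by (auto simp: eventually_at dist_real_def)
  \<comment> \<open>The entries serve, in order: to keep the energy of the shifted function above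
    the boundary maximum, to keep scaled shifts of size up to 2 e inside the box, to preserve the
    values of v beyond 1 and -1 up to sign change, and to preserve the sign at x.\<close>
  define e where "e = Min ({d / 2, r / 2, 1 / 2} \<union> (if v x = 0 then {} else {\<bar>v x\<bar> / 2}))"
  have e: "e > 0" "e < d" "2 * e \<le> r" "e < 1" "v x \<noteq> 0 \<Longrightarrow> e < \<bar>v x\<bar>"
    using d(1) r by (auto simp: e_def)
  \<comment> \<open>The sign opposite to \<open>D\<close> makes the shift a descent
    direction.\<close>
  define \<epsilon> where "\<epsilon> = - sgn D * e"
  have eps: "\<epsilon> \<noteq> 0" "\<bar>\<epsilon>\<bar> = e" using D e by (auto simp: \<epsilon>_def abs_mult abs_sgn_eq sgn_zero_iff)
  define u where "u = (\<lambda>y. v y + \<epsilon> * unit_at x y)"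
  have Ju: "?J (comb v (fst zB) (snd zB)) < ?J u"
    unfolding u_def using d(2)[of \<epsilon>] eps e by auto
  have scu: "sign_changing u"
  proof -
    obtain y1 y2 where y: "v y1 > 1" "v y2 < - 1" using M_set_large_values[OF vM] by blast
    have le: "\<bar>\<epsilon> * unit_at x y\<bar> < 1" for y using eps e by (simp add: unit_at_def)
    have "u y1 > 0" "u y2 < 0" unfolding u_def using y le[of y1] le[of y2] by linarith+
    then show ?thesis
      using finite_energy_shift[OF fe, of \<epsilon> x] unfolding sign_changing_iff u_def by blast
  qed
  have lower: "?J (comb u s t) < ?J (comb v s t)" if "(s, t) \<in> Sq" for s t
  proof -
    have st: "\<bar>s - 1\<bar> \<le> r" "\<bar>t - 1\<bar> \<le> r" "s > 0" "t > 0" "s \<le> 2" "t \<le> 2"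
      using that r by (auto simp: Sq_def abs_le_iff)
    have neg: "\<epsilon> * dJ w a b p h (\<lambda>y. comb v s t y + \<eta> * unit_at x y) (unit_at x) < 0"
      if "\<bar>\<eta>\<bar> \<le> m * \<bar>\<epsilon>\<bar>" "m \<le> 2" for \<eta> m
    proof -
      have "m * \<bar>\<epsilon>\<bar> \<le> 2 * \<bar>\<epsilon>\<bar>" using that(2) by (intro mult_right_mono) auto
      then have "\<bar>\<eta>\<bar> \<le> 2 * e" using that(1) eps(2) by linarith
      then have "D * DD (s, t, \<eta>) > 0" using pos st e by auto
      then have "0 < sgn D * DD (s, t, \<eta>)"
        by (auto simp: zero_less_mult_iff)
      from mult_pos_pos[OF e(1) this] show ?thesis by (simp add: \<epsilon>_def DD_def mult_ac)
    qed
    have c: "v x \<noteq> 0 \<and> \<bar>\<epsilon>\<bar> < \<bar>v x\<bar> \<or> v x = 0 \<and> \<epsilon> \<noteq> 0" using e eps by auto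
    \<comment> \<open>If v x = 0, the sign of \<epsilon> decides which part the point x
      joins.\<close>
    consider "v x \<ge> 0" "v x + \<epsilon> > 0" | "v x \<le> 0" "v x + \<epsilon> < 0"
      using c by linarith
    then show ?thesis
    proof cases
      case 1
      show ?thesis unfolding u_def comb_unit_shift_pos(1)[of v x, OF 1]
        by (rule Jfun_decreases_along_shift[OF finite_energy_comb[OF fe] st(3) comb_unit_shift_pos(2)[of v x, OF 1] c neg[OF _ st(5)] eps(1)])
    next
      case 2
      show ?thesis unfolding u_def comb_unit_shift_neg(1)[of v x, OF 2]
        by (rule Jfun_decreases_along_shift[OF finite_energy_comb[OF fe] st(4) comb_unit_shift_neg(2)[of v x, OF 2] c neg[OF _ st(6)] eps(1)])
    qed
  qed
  obtain z where z: "z \<in> Sq" "\<And>z'. z' \<in> Sq \<Longrightarrow> ?J (comb u (fst z') (snd z')) \<le> ?J (comb u (fst z) (snd z))"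
    using continuous_attains_sup[OF Sq(1,2) continuous_on_subset[OF continuous_Jfun_comb[OF scu] Sq(3)]] by blast
  define s t where "s = fst z" and "t = snd z"
  have st: "(s, t) \<in> Sq" using z(1) by (simp add: s_def t_def)
  then have st0: "s > 0" "t > 0" using r by (auto simp: Sq_def)
  \<comment> \<open>On the boundary the fibre energy of u is below that of v, which is below the
    energy of u itself; the maximum over the square is at least the latter.\<close>
  have "(s, t) \<notin> B"
  proof
    assume "(s, t) \<in> B"
    then have "?J (comb v s t) \<le> ?J (comb v (fst zB) (snd zB))" using zB(2)[of "(s, t)"] by simp
    moreover have "?J u \<le> ?J (comb u s t)" using z(2)[OF Sq(4)] by (simp add: s_def t_def)
    ultimately show False using lower[OF st] Ju by linarith
  qed
  with st have int: "\<bar>s - 1\<bar> < r" "\<bar>t - 1\<bar> < r" by (auto simp: B_def Sq_def abs_less_iff)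
  have "comb u s t \<in> ?M"
  proof (rule comb_local_max_in_M_set[OF scu st0])
    show "min (r - \<bar>s - 1\<bar>) (r - \<bar>t - 1\<bar>) > 0" using int by simp
    fix s' t' assume "\<bar>s - s'\<bar> < min (r - \<bar>s - 1\<bar>) (r - \<bar>t - 1\<bar>)" "\<bar>t - t'\<bar> < min (r - \<bar>s - 1\<bar>) (r - \<bar>t - 1\<bar>)"
    then have "(s', t') \<in> Sq" by (auto simp: Sq_def)
    then show "?J (comb u s' t') \<le> ?J (comb u s t)" using z(2)[of "(s', t')"] by (simp add: s_def t_def)
  qed
  \<comment> \<open>The new element has smaller energy than s v^+ + t v^-, whose energy is at most
    that of v.\<close>
  from min[OF this] lower[OF st] Jfun_comb_le(1)[OF vM, of s t] st0 show False by linarith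
qed

text \<open>After integration by parts the derivative in direction \<phi> is the sum of \<phi> x
  times the derivative at the point mass in x, so neither density nor continuity of the derivative
  is invoked.\<close>

lemma critical_if_critical_unit:
  assumes fe: "finite_energy v" "finite_energy \<phi>"
    and crit: "\<And>x. dJ w a b p h v (unit_at x) = 0"
  shows "dJ w a b p h v \<phi> = 0"
proof -
  note ss = fe[THEN finite_energy_square_summable(1)] finite_energy_square_summable(1)[OF finite_energy_unit_at]
  have lap: "Q v (unit_at x) = lap v x" for x
    using Q_by_parts(2)[OF ss(1) ss(3)] infsum_unit_at[of "lap v" x] by (simp add: mult.commute)
  let ?A = "a + b * Q v v"
  have s1: "(\<lambda>x. ?A * (\<phi> x * lap v x)) summable_on UNIV"
    by (intro summable_on_cmult_right Q_by_parts ss)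
  note s2 = V_summable[OF fe] and s3 = nonlinear_summable(3)[OF fe(1) fe(2)]
  have "(\<Sum>\<^sub>\<infinity>x. ?A * (\<phi> x * lap v x) + h x * v x * \<phi> x + - (fnl p (v x) * \<phi> x)) = (\<Sum>\<^sub>\<infinity>x. \<phi> x * dJ w a b p h v (unit_at x))"
    by (intro infsum_cong) (simp add: dJ_unit_at[OF fe(1)] lap algebra_simps)
  also have "\<dots> = 0" by (simp add: crit)
  also have "(\<Sum>\<^sub>\<infinity>x. ?A * (\<phi> x * lap v x) + h x * v x * \<phi> x + - (fnl p (v x) * \<phi> x))
     = (\<Sum>\<^sub>\<infinity>x. ?A * (\<phi> x * lap v x)) + V v \<phi> - (\<Sum>\<^sub>\<infinity>x. fnl p (v x) * \<phi> x)"
    unfolding V_def using s3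
    by (subst infsum_add[OF summable_on_add[OF s1 s2]])
      (auto simp: infsum_add[OF s1 s2] infsum_uminus summable_on_uminus)
  finally show ?thesis
    unfolding dJ_eq[OF fe] Q_by_parts(2)[OF ss(1,2)] by (simp add: infsum_cmult_right')
qed

lemma ground_state_sign_changing:
  "\<exists>v \<in> M_set w a b p h. (\<forall>\<phi> \<in> H_space w h. dJ w a b p h v \<phi> = 0)
     \<and> (\<forall>u \<in> M_set w a b p h. Jfun w a b p h v \<le> Jfun w a b p h u)"
proof -
  obtain v where v: "v \<in> M_set w a b p h" "\<And>u. u \<in> M_set w a b p h \<Longrightarrow> Jfun w a b p h v \<le> Jfun w a b p h u"
    using minimiser_exists by blast
  have "finite_energy v" using M_set_sign_changing[OF v(1)] by (simp add: sign_changing_iff)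
  then have "dJ w a b p h v \<phi> = 0" if "\<phi> \<in> H_space w h" for \<phi>
    using that critical_if_critical_unit minimiser_critical_unit[OF v] by (simp add: H_space_iff)
  with v show ?thesis by blast
qed

end

theorem theorem1p2:
  fixes w :: "int^'n \<Rightarrow> int^'n \<Rightarrow> real" and h :: "int^'n \<Rightarrow> real"
    and s a b p :: real
  assumes s: "0 < s" "s < 1"
    and w_sym: "\<forall>x y. w x y = w y x"
    and w_pos: "\<forall>x y. x \<noteq> y \<longrightarrow> 0 < w x y"
    and w_bounds: "\<exists>c C. 0 < c \<and> c \<le> C \<and> (\<forall>x y. x \<noteq> y \<longrightarrow>
        c * real_of_int (ldist x y) powr (- (real CARD('n) + 2 * s)) \<le> w x y \<and>
        w x y \<le> C * real_of_int (ldist x y) powr (- (real CARD('n) + 2 * s)))"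
    and ab: "0 < a" "0 < b"
    and p: "p > 6"
    and h1: "\<exists>h0>0. \<forall>x. h x \<ge> h0"
    and h2: "\<exists>x0. \<forall>M. \<exists>R. \<forall>x. real_of_int (ldist x x0) \<ge> R \<longrightarrow> h x \<ge> M"
  shows "\<exists>v \<in> M_set w a b p h.
           (\<forall>\<phi> \<in> H_space w h. dJ w a b p h v \<phi> = 0)
         \<and> (\<forall>u \<in> M_set w a b p h. Jfun w a b p h v \<le> Jfun w a b p h u)"
proof -
  obtain C where C: "0 \<le> C"
    and w_le: "\<And>x y. x \<noteq> y \<Longrightarrow> w x y \<le> C * real_of_int (ldist x y) powr - (real CARD('n) + 2 * s)"
    using w_bounds by (meson less_imp_le order_trans)
  \<comment> \<open>The row sums are finite because the exponent d + 2 s exceeds the dimension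
    d.\<close>
  obtain W where W: "\<And>x. w x summable_on (UNIV - {x})" "\<And>x. infsum (w x) (UNIV - {x}) \<le> W"
  proof (rule weight_row_sums_bounded[of "real CARD('n) + 2 * s" C w])
    show "0 \<le> w x y \<and> w x y \<le> C * real_of_int (ldist x y) powr - (real CARD('n) + 2 * s)" if "x \<noteq> y" for x y
      using w_le[OF that] w_pos that by (simp add: less_imp_le)
  qed (use C s that in auto)
  obtain h0 where h0: "h0 > 0" "\<And>x. h x \<ge> h0" using h1 by blast
  obtain x0 where "\<forall>M. \<exists>R. \<forall>x. real_of_int (ldist x x0) \<ge> R \<longrightarrow> h x \<ge> M" using h2 by blast
  then have sublevel: "finite {x. h x < M}" for M by (rule finite_sublevel)
  have "kirchhoff w h a b p W h0"
    by unfold_locales (use w_sym w_pos W h0 sublevel ab p in \<open>auto simp: less_imp_le\<close>)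
  then show ?thesis by (rule kirchhoff.ground_state_sign_changing)
qed

end
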